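(* There exists a map $f \in \mathcal{D} \cap C^\infty(\mathbb{S}^1\setminus\{q\})$, where $p$ is the unique fixed point of $f$ and $q$ is the unique preimage of $p$ under $f$ other than $p$ itself, such that $p$ is a Sisyphus Attractor (i.e. $|f'(p)|>1$ and $|B_{\delta_p}|>0$) and moreover $|B_{\delta_p}|=1$.
   Context: $\mathbb{S}^1=\mathbb{R}/\mathbb{Z}$ is the circle and $|\cdot|$ applied to sets denotes Lebesgue measure on $\mathbb{S}^1$ (total mass $1$). $\mathcal{D}$ is the set of local homeomorphisms $f:\mathbb{S}^1\to\mathbb{S}^1$ that are topologically conjugate to the doubling map $x\mapsto 2x \bmod 1$; each such $f$ has a unique fixed point $p$, and $p$ has exactly one preimage $q\neq p$. $f\in C^\infty(\mathbb{S}^1\setminus\{q\})$ means that $f$ is infinitely differentiable at every point of $\mathbb{S}^1\setminus\{q\}$. For a Borel probability measure $\mu$ on $\mathbb{S}^1$, its basin is $B_\mu=\{x\in\mathbb{S}^1 : \frac1n\sum_{i=0}^{n-1}\delta_{f^i(x)}\to\mu \text{ weakly as } n\to\infty\}$. $\delta_p$ is the Dirac measure at $p$. The fixed point $p$ is called a Sisyphus Attractor if $|f'(p)|>1$ and $|B_{\delta_p}|>0$. *)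

theory Defs
  imports "HOL-Probability.Probability"
begin

section \<open>The circle as the quotient of the reals by the integers\<close>

quotient_type circle = real / "\<lambda>x y :: real. x - y \<in> \<int>"
proof (rule equivpI)
  show "reflp (\<lambda>x y :: real. x - y \<in> \<int>)"
    by (simp add: reflp_def)
  show "symp (\<lambda>x y :: real. x - y \<in> \<int>)"
    by (rule sympI) (metis Ints_minus minus_diff_eq)
  show "transp (\<lambda>x y :: real. x - y \<in> \<int>)"
    by (rule transpI) (use Ints_add in fastforce)
qed

lift_definition circle_of :: "real \<Rightarrow> circle" is "\<lambda>t. t" .

lemma circle_of_eq_iff: "circle_of s = circle_of t \<longleftrightarrow> s - t \<in> \<int>"
  by transfer simp

lemma surj_circle_of: "surj circle_of"
  unfolding surj_def by transfer (metis Ints_0 diff_self)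

text \<open>The quotient topology.\<close>

instantiation circle :: topological_space
begin

definition open_circle :: "circle set \<Rightarrow> bool"
  where "open_circle U \<longleftrightarrow> open (circle_of -` U)"

instance
  by standard (auto simp: open_circle_def vimage_Union)

end

lemma continuous_on_circle_of: "continuous_on UNIV circle_of"
  by (simp add: continuous_on_open_vimage open_circle_def)

lemma measurable_circle_of [measurable]: "circle_of \<in> borel_measurable borel"
  by (rule borel_measurable_continuous_onI[OF continuous_on_circle_of])

text \<open>Lebesgue measure of total mass one, defined on all Lebesgue measurable sets.\<close>

definition lebesgue_circle :: "circle measure"
  where "lebesgue_circle =
    completion (distr (restrict_space lborel {0..<1}) borel circle_of)"


section \<open>Maps conjugate to the doubling map\<close>

lift_definition doubling :: "circle \<Rightarrow> circle" is "\<lambda>t. 2 * t"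
  by (simp only: Ints_mult Ints_numeral flip: right_diff_distrib)

definition local_homeomorphism :: "('a::topological_space \<Rightarrow> 'b::topological_space) \<Rightarrow> bool"
  where "local_homeomorphism f \<longleftrightarrow>
    (\<forall>x. \<exists>U. open U \<and> x \<in> U \<and> open (f ` U) \<and> (\<exists>g. homeomorphism U (f ` U) f g))"

definition topologically_conjugate ::
    "('a::topological_space \<Rightarrow> 'a) \<Rightarrow> ('b::topological_space \<Rightarrow> 'b) \<Rightarrow> bool"
  where "topologically_conjugate f g \<longleftrightarrow>
    (\<exists>h h'. homeomorphism UNIV UNIV h h' \<and> h \<circ> f = g \<circ> h)"

definition doubling_class :: "(circle \<Rightarrow> circle) set"
  where "doubling_class =
    {f. local_homeomorphism f \<and> topologically_conjugate f doubling}"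


section \<open>Differentiability of circle maps\<close>

text \<open>Derivatives are those of local lifts to the real line. Any two lifts that are
  continuous at a point differ by a constant integer near it, so the derivative does not
  depend on the lift.\<close>

definition has_circle_derivative :: "(circle \<Rightarrow> circle) \<Rightarrow> real \<Rightarrow> circle \<Rightarrow> bool"
  where "has_circle_derivative f D x \<longleftrightarrow>
    (\<exists>t F. circle_of t = x \<and>
      (\<forall>\<^sub>F s in nhds t. circle_of (F s) = f (circle_of s)) \<and>
      (F has_real_derivative D) (at t))"

text \<open>All derivatives are required to exist on a neighbourhood. On an open set this is the
  same as having derivatives of every order at each point, since the derivative of order
  \<open>k + 1\<close> at a point needs the one of order \<open>k\<close> to exist nearby.\<close>

definition smooth_circle_map_on :: "(circle \<Rightarrow> circle) \<Rightarrow> circle set \<Rightarrow> bool"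
  where "smooth_circle_map_on f A \<longleftrightarrow>
    (\<forall>x\<in>A. \<exists>t F V. circle_of t = x \<and> open V \<and> t \<in> V \<and>
      (\<forall>s\<in>V. circle_of (F s) = f (circle_of s)) \<and>
      (\<forall>k. \<forall>s\<in>V. ((deriv ^^ k) (F :: real \<Rightarrow> real)) field_differentiable (at s)))"


section \<open>Basins and Sisyphus attractors\<close>

definition converges_weakly :: "(nat \<Rightarrow> 'a::topological_space measure) \<Rightarrow> 'a measure \<Rightarrow> bool"
  where "converges_weakly M \<mu> \<longleftrightarrow>
    (\<forall>\<phi> :: 'a \<Rightarrow> real. continuous_on UNIV \<phi> \<and> bounded (range \<phi>) \<longrightarrow>
      (\<lambda>n. integral\<^sup>L (M n) \<phi>) \<longlonglongrightarrow> integral\<^sup>L \<mu> \<phi>)"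

text \<open>The average of the Dirac measures along an orbit, obtained as the image of the uniform
  distribution on times.\<close>

definition empirical_measure ::
    "('a::topological_space \<Rightarrow> 'a) \<Rightarrow> 'a \<Rightarrow> nat \<Rightarrow> 'a measure"
  where "empirical_measure f x n =
    distr (uniform_count_measure {..<n}) borel (\<lambda>i. (f ^^ i) x)"

lemma emeasure_empirical_measure:
  assumes "n > 0" and A: "A \<in> sets borel"
  shows "emeasure (empirical_measure f x n) A =
    ennreal (1 / real n) * (\<Sum>i<n. emeasure (return borel ((f ^^ i) x)) A)"
proof -
  let ?S = "(\<lambda>i. (f ^^ i) x) -` A \<inter> {..<n}"
  have "emeasure (empirical_measure f x n) A = emeasure (uniform_count_measure {..<n}) ?S"
    unfolding empirical_measure_def
    by (subst emeasure_distr) (auto simp: A space_uniform_count_measure measurable_def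
        sets_uniform_count_measure)
  also have "\<dots> = ennreal (real (card ?S) / real n)"
    using assms(1) by (subst emeasure_uniform_count_measure) auto
  also have "real (card ?S) = (\<Sum>i<n. indicator A ((f ^^ i) x))"
  proof -
    have "{..<n} \<inter> {i. (f ^^ i) x \<in> A} = ?S"
      by auto
    then show ?thesis
      by (simp add: indicator_def sum.If_cases)
  qed
  also have "ennreal ((\<Sum>i<n. indicator A ((f ^^ i) x)) / real n) =
      ennreal (1 / real n) * (\<Sum>i<n. ennreal (indicator A ((f ^^ i) x)))"
  proof -
    have "ennreal ((\<Sum>i<n. indicator A ((f ^^ i) x)) / real n) =
        ennreal (1 / real n * (\<Sum>i<n. indicator A ((f ^^ i) x)))"
      by (simp only: times_divide_eq_left mult_1)
    also have "\<dots> = ennreal (1 / real n) * ennreal (\<Sum>i<n. indicator A ((f ^^ i) x))"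
      by (rule ennreal_mult') simp
    also have "ennreal (\<Sum>i<n. indicator A ((f ^^ i) x)) =
        (\<Sum>i<n. ennreal (indicator A ((f ^^ i) x)))"
      by (rule sum_ennreal[symmetric]) (rule indicator_pos_le)
    finally show ?thesis .
  qed
  also have "(\<Sum>i<n. ennreal (indicator A ((f ^^ i) x))) =
      (\<Sum>i<n. emeasure (return borel ((f ^^ i) x)) A)"
    by (simp only: emeasure_return[OF A] ennreal_indicator)
  finally show ?thesis .
qed

definition basin :: "('a::topological_space \<Rightarrow> 'a) \<Rightarrow> 'a measure \<Rightarrow> 'a set"
  where "basin f \<mu> = {x. converges_weakly (empirical_measure f x) \<mu>}"

definition sisyphus_attractor :: "(circle \<Rightarrow> circle) \<Rightarrow> circle \<Rightarrow> bool"
  where "sisyphus_attractor f p \<longleftrightarrow>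
    f p = p \<and>
    (\<exists>D. has_circle_derivative f D p \<and> \<bar>D\<bar> > 1) \<and>
    emeasure lebesgue_circle (basin f (return borel p)) > 0"

end

theory Submission
  imports Defs
begin

text \<open>
  The map has a closed form. Put $\Phi(t) = \exp(2 - 2/t^4)$ on $(0,1]$ and $\Phi(0) = 0$: an
  increasing convex bijection of $[0,1]$, infinitely flat at $0$. Reading the circle as
  $[0,1]$ with the ends glued, let $c$ be the point with $\Phi(c) = 1/2$ and follow $\Phi$ by
  $t \mapsto 2t + c$. This fixes $c$, sends the gluing point to $c$ as well, and is real analytic
  off the gluing point. Translating $c$ to $0$, the fixed point is $p = 0$, its other preimage is
  $q = 1 - c$, and the two branches $[0,q]$ and $[q,1]$ both map onto $[0,1]$. Each branch
  is increasing and convex, being a piece of the graph of $2\Phi$ up to translation.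

  Convexity replaces all distortion estimates. A branch of an iterate $f^n$ is a composition of
  increasing convex maps, hence is itself increasing and convex, so on the interval of points with a
  given itinerary $f^n$ rises more slowly at the left end than at the right end. Consequently,
  among the points that enter $[q,1]$ at time $n$ along this itinerary, those that land so
  close to $q$ that their next $N$ positions lie in $[0,q]$ have proportion at least the length
  of the trap $[q, q + w_N)$ of such landing points (lemma \<open>trap_le_len\<close>). As $\Phi$ is flat to
  the order $\exp(-2/t^4)$, $w_N$ is at least of order $N^{-1/4}$
  (lemma \<open>trap_lower_bound\<close>).

  A point that visits $[q,1]$ more than $k$ times up to time $N$ has $k$ consecutive gaps
  shorter than $N$, which confines it to a set of measure at most $(1 - w_N)^k$. For
  $N = k^2$ this is at most $\exp(-a \sqrt k)$ with some $a > 0$, which is summable, so by Borel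
  and Cantelli almost every point visits $[q,1]$ at most $k$ times up to time $k^2$ for large $k$: the visits have
  density $0$. A point of $[\varepsilon, q)$ is expelled from $[0,q]$ within a number of steps that
  depends only on $\varepsilon$, so the times spent outside $[0,\varepsilon)$ have density $0$
  too, and the orbit averages converge to the Dirac measure at $p$.

  The conjugacy to the doubling map is the limit $h$ of $F^n / 2^n$ for a lift $F$. It is
  injective because $F$ is expansive: an itinerary that meets $[q,1]$ infinitely often has
  intervals shrinking to a point, since by convexity each meeting costs a factor $1 - q$; and along
  any other itinerary distances to the fixed point grow geometrically.
\<close>

section \<open>Circle maps given by lifts\<close>

lemma circle_of_add_int [simp]: "circle_of (x + of_int m) = circle_of x"
  by (simp add: circle_of_eq_iff)

lemma doubling_circle_of: "doubling (circle_of t) = circle_of (2 * t)"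
  by transfer simp

lemma open_circle_of_image:
  assumes "open V"
  shows "open (circle_of ` V)"
proof -
  have "circle_of -` circle_of ` V = (\<Union>m::int. (+) (of_int m) ` V)"
  proof (intro equalityI subsetI)
    fix x assume "x \<in> circle_of -` circle_of ` V"
    then obtain v m where "v \<in> V" "x - v = of_int m"
      by (auto simp: circle_of_eq_iff Ints_def)
    then show "x \<in> (\<Union>m::int. (+) (of_int m) ` V)"
      by (auto intro!: exI[of _ m] image_eqI[of _ _ v])
  qed (auto simp: add.commute[of "of_int _"])
  then show ?thesis
    using assms by (auto simp: open_circle_def intro!: open_translation)
qed

definition circle_map :: "(real \<Rightarrow> real) \<Rightarrow> circle \<Rightarrow> circle"
  where "circle_map F c = circle_of (F (inv circle_of c))"

lemma lift_add_int:
  fixes F :: "real \<Rightarrow> real" and d :: int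
  assumes "\<And>x. F (x + 1) = F x + of_int d"
  shows "F (x + of_int m) = F x + of_int (d * m)"
proof (induction m arbitrary: x rule: int_induct[where k = 0])
  case base
  show ?case by simp
next
  case (step1 m)
  have "F (x + of_int (m + 1)) = F (x + of_int m) + of_int d"
    using assms[of "x + of_int m"] by (simp add: add.assoc)
  with step1 show ?case by (simp add: algebra_simps)
next
  case (step2 m)
  have "F (x + of_int m) = F (x + of_int (m - 1)) + of_int d"
    using assms[of "x + of_int (m - 1)"] by (simp add: algebra_simps)
  with step2 show ?case by (simp add: algebra_simps)
qed

lemma circle_map_circle_of:
  fixes d :: int
  assumes "\<And>x. F (x + 1) = F x + of_int d"
  shows "circle_map F (circle_of x) = circle_of (F x)"
proof -
  have "circle_of (inv circle_of (circle_of x)) = circle_of x"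
    by (simp add: surj_f_inv_f surj_circle_of)
  then obtain m where "inv circle_of (circle_of x) = x + of_int m"
    by (metis Ints_cases circle_of_eq_iff diff_add_cancel add.commute)
  then show ?thesis
    unfolding circle_map_def by (simp only: lift_add_int[where F = F, OF assms] circle_of_add_int)
qed

lemma continuous_on_circle_map:
  fixes d :: int
  assumes "\<And>x. F (x + 1) = F x + of_int d" and "continuous_on UNIV F"
  shows "continuous_on UNIV (circle_map F)"
proof (subst continuous_on_open_vimage[OF open_UNIV], intro allI impI)
  fix B :: "circle set" assume "open B"
  have "circle_of -` (circle_map F -` B) = F -` (circle_of -` B)"
    by (auto simp: circle_map_circle_of[where F = F, OF assms(1)])
  also have "open \<dots>"
    using \<open>open B\<close> assms(2) by (intro open_vimage[of "circle_of -` B"]) (simp_all add: open_circle_def)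
  finally show "open (circle_map F -` B \<inter> UNIV)"
    by (simp add: open_circle_def)
qed

lemma continuous_strict_mono_surj:
  fixes F :: "real \<Rightarrow> real"
  assumes "strict_mono F" "surj F"
  shows "continuous_on UNIV F"
  using assms by (intro continuous_onI_mono) (auto intro: strict_mono_leD)

lemma open_image_strict_mono_surj:
  fixes F :: "real \<Rightarrow> real"
  assumes "strict_mono F" "surj F" "open V"
  shows "open (F ` V)"
proof -
  have inj: "inj F" using assms(1) by (rule strict_mono_imp_inj_on)
  have "strict_mono (inv F)"
    by (rule strict_monoI) (metis assms(1,2) strict_mono_less surj_f_inv_f)
  moreover have "surj (inv F)" using inj by (rule inj_imp_surj_inv)
  ultimately have "open (inv F -` V)"
    using assms(3) by (intro open_vimage continuous_strict_mono_surj)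
  moreover have "F ` V = inv F -` V"
    using inj assms(2) by (auto simp: image_iff surj_f_inv_f) (metis surj_f_inv_f)
  ultimately show ?thesis by simp
qed

text \<open>
  A lift is an open map of the line, hence its circle map is open; on a neighbourhood that the lift
  maps into an interval of length less than $1$ it is injective, because there two values that agree
  modulo $1$ are equal.
\<close>

lemma local_homeomorphism_circle_map:
  fixes d :: int
  assumes shift: "\<And>x. F (x + 1) = F x + of_int d" and F: "strict_mono F" "surj F"
  shows "local_homeomorphism (circle_map F)"
  unfolding local_homeomorphism_def
proof
  fix c
  note [simp] = circle_map_circle_of[where F = F, OF shift]
  have cont: "continuous_on UNIV F" by (rule continuous_strict_mono_surj[OF F])
  have open_map: "open (circle_map F ` U)" if "open U" for U
  proof -
    have "circle_map F ` U = circle_of ` F ` (circle_of -` U)"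
    proof (intro equalityI subsetI)
      fix y assume "y \<in> circle_map F ` U"
      then obtain u where u: "u \<in> U" "y = circle_map F u" by auto
      obtain t where t: "u = circle_of t" using surj_circle_of by (auto simp: surj_def)
      show "y \<in> circle_of ` F ` (circle_of -` U)" using u t by auto
    next
      fix y assume "y \<in> circle_of ` F ` (circle_of -` U)"
      then obtain t where "circle_of t \<in> U" "y = circle_map F (circle_of t)" by auto
      then show "y \<in> circle_map F ` U" by blast
    qed
    then show ?thesis
      using that open_circle_of_image[OF open_image_strict_mono_surj[OF F]]
      by (simp add: open_circle_def[of U])
  qed
  obtain t where t: "c = circle_of t" using surj_circle_of by (auto simp: surj_def)
  define V where "V = F -` {F t - 1/2 <..< F t + 1/2}"
  define U where "U = circle_of ` V"
  have "open V" unfolding V_def using cont by (intro open_vimage) auto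
  then have U: "open U" unfolding U_def by (rule open_circle_of_image)
  have "c \<in> U" by (auto simp: U_def V_def t)
  have inj: "inj_on (circle_map F) U"
  proof (rule inj_onI)
    fix x y assume "x \<in> U" "y \<in> U" and eq: "circle_map F x = circle_map F y"
    then obtain s u where su: "s \<in> V" "u \<in> V" "x = circle_of s" "y = circle_of u"
      by (auto simp: U_def)
    with eq have "F s - F u \<in> \<int>" by (simp add: circle_of_eq_iff)
    moreover have "\<bar>F s - F u\<bar> < 1" using su(1,2) by (auto simp: V_def)
    ultimately have "F s = F u"
      by (metis Ints_nonzero_abs_less1 eq_iff_diff_eq_0)
    then show "x = y" using F(1) su by (metis strict_mono_eq)
  qed
  have "continuous_on U (circle_map F)"
    using continuous_on_circle_map[where F = F, OF shift cont] by (rule continuous_on_subset) simp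
  then obtain g where "homeomorphism U (circle_map F ` U) (circle_map F) g"
  proof (rule homeomorphism_injective_open_map[OF _ refl inj])
    fix S assume "openin (top_of_set U) S"
    then have S: "open S" "S \<subseteq> U" using U by (auto simp: openin_open_eq)
    then show "openin (top_of_set (circle_map F ` U)) (circle_map F ` S)"
      by (simp add: openin_open_eq open_map U image_mono)
  qed
  with U \<open>c \<in> U\<close> open_map[OF U]
  show "\<exists>U. open U \<and> c \<in> U \<and> open (circle_map F ` U) \<and>
      (\<exists>g. homeomorphism U (circle_map F ` U) (circle_map F) g)"
    by blast
qed

lemma homeomorphism_circle_map:
  assumes shift: "\<And>x. H (x + 1) = H x + 1" and H: "strict_mono H" "surj H"
  shows "homeomorphism UNIV UNIV (circle_map H) (circle_map (inv H))"
proof -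
  have inj: "inj H" using H(1) by (rule strict_mono_imp_inj_on)
  have shift': "inv H (y + 1) = inv H y + 1" for y
    by (metis H(2) inj inv_f_f shift surj_f_inv_f)
  have mono': "strict_mono (inv H)"
    by (rule strict_monoI) (metis H strict_mono_less surj_f_inv_f)
  have surj': "surj (inv H)" using inj by (rule inj_imp_surj_inv)
  have lift: "circle_map H (circle_of x) = circle_of (H x)"
    "circle_map (inv H) (circle_of x) = circle_of (inv H x)" for x
    using circle_map_circle_of[of H 1 x] circle_map_circle_of[of "inv H" 1 x] shift shift'
    by simp_all
  have *: "circle_map (inv H) (circle_map H c) = c" "circle_map H (circle_map (inv H) c) = c" for c
    using surjD[OF surj_circle_of, of c] inj H(2) by (auto simp: lift surj_f_inv_f)
  then have "surj (circle_map H)" "surj (circle_map (inv H))"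
    by (metis surjI)+
  moreover have "continuous_on UNIV (circle_map H)" "continuous_on UNIV (circle_map (inv H))"
    using continuous_on_circle_map[of H 1] continuous_on_circle_map[of "inv H" 1] shift shift'
      continuous_strict_mono_surj[OF H] continuous_strict_mono_surj[OF mono' surj']
    by simp_all
  ultimately show ?thesis
    using * by (auto simp: homeomorphism_def)
qed

text \<open>
  The representative in $[0,1)$. It is discontinuous at one point only, hence Borel, and so carries
  Borel sets of reals back to Borel sets of the circle.
\<close>

definition circle_frac :: "circle \<Rightarrow> real"
  where "circle_frac c = frac (inv circle_of c)"

lemma circle_of_frac [simp]: "circle_of (frac x) = circle_of x"
  by (simp add: circle_of_eq_iff frac_def)

lemma circle_of_circle_frac [simp]: "circle_of (circle_frac c) = c"
  by (simp add: circle_frac_def surj_f_inv_f surj_circle_of)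

lemma circle_frac_bounds: "0 \<le> circle_frac c" "circle_frac c < 1"
  by (simp_all add: circle_frac_def frac_lt_1)

lemma circle_frac_circle_of: "circle_frac (circle_of x) = frac x"
proof -
  have "circle_of (circle_frac (circle_of x)) = circle_of (frac x)" by simp
  then have "circle_frac (circle_of x) - frac x \<in> \<int>" by (simp only: circle_of_eq_iff)
  moreover have "\<bar>circle_frac (circle_of x) - frac x\<bar> < 1"
    using circle_frac_bounds[of "circle_of x"] frac_lt_1[of x] frac_ge_0[of x] by linarith
  ultimately show ?thesis by (metis Ints_nonzero_abs_less1 eq_iff_diff_eq_0)
qed

lemma borel_measurable_circle_frac [measurable]: "circle_frac \<in> borel_measurable borel"
proof (rule borel_measurableI_less)
  fix a :: real
  have "closed {circle_of 0}"
  proof -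
    have "circle_of -` (- {circle_of 0}) = - \<int>"
      by (auto simp: circle_of_eq_iff)
    then have "open (- {circle_of 0})" by (simp add: open_circle_def open_Compl)
    then show ?thesis by (simp add: closed_def)
  qed
  moreover have "open (circle_of ` {0<..<min a 1})" by (rule open_circle_of_image) simp
  moreover have "{c. circle_frac c < a} =
    (if a \<le> 0 then {} else circle_of ` {0<..<min a 1} \<union> {circle_of 0})"
  proof (cases "a \<le> 0")
    case True
    then show ?thesis using circle_frac_bounds(1) by (auto simp: not_less intro: order_trans)
  next
    case False
    have "c \<in> circle_of ` {0<..<min a 1} \<union> {circle_of 0}" if "circle_frac c < a" for c
    proof (cases "circle_frac c = 0")
      case True
      then show ?thesis by (metis Un_iff circle_of_circle_frac singletonI)
    next
      case False
      then have "circle_frac c \<in> {0<..<min a 1}"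
        using that circle_frac_bounds[of c] by auto
      then show ?thesis by (metis UnI1 circle_of_circle_frac image_eqI)
    qed
    moreover have "circle_frac c < a"
      if "c \<in> circle_of ` {0<..<min a 1} \<union> {circle_of 0}" for c
      using that False by (auto simp: circle_frac_circle_of frac_eq)
    ultimately show ?thesis using False by auto
  qed
  ultimately show "{c \<in> space borel. circle_frac c < a} \<in> sets borel"
    by (simp only: space_borel UNIV_I simp_thms) (auto intro: sets.Un borel_open borel_closed simp del: Un_insert_right)
qed

text \<open>
  Measurability of the set is part of the conclusion: its complement lies in a Borel null set, and
  the measure on the circle is complete.
\<close>

lemma emeasure_lebesgue_circle_eq_1:
  assumes "AE x in lborel. 0 \<le> x \<longrightarrow> x < 1 \<longrightarrow> circle_of x \<in> B"
  shows "emeasure lebesgue_circle B = 1"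
proof -
  define M where "M = distr (restrict_space lborel {0..<1::real}) borel circle_of"
  have meas: "circle_of \<in> measurable (restrict_space lborel {0..<1::real}) borel"
    by (rule measurable_restrict_space1) measurable
  have M: "emeasure M A = emeasure lborel (circle_of -` A \<inter> {0..<1})" if "A \<in> sets borel" for A
    unfolding M_def using that
    by (subst emeasure_distr[OF meas]) (auto simp: emeasure_restrict_space space_restrict_space)
  obtain N where N: "{x. \<not> (0 \<le> x \<longrightarrow> x < 1 \<longrightarrow> circle_of x \<in> B)} \<subseteq> N"
      "emeasure lborel N = 0" "N \<in> sets lborel"
    using AE_E[OF assms] by auto
  define Z where "Z = {c. circle_frac c \<in> N}"
  have Z: "Z \<in> sets borel"
  proof -
    have "circle_frac -` N \<inter> space borel \<in> sets borel"
      using N(3) by (intro measurable_sets[OF borel_measurable_circle_frac]) simp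
    then show ?thesis by (simp add: Z_def vimage_def)
  qed
  have "emeasure lborel (circle_of -` Z \<inter> {0..<1}) \<le> emeasure lborel N"
    using N(3) by (intro emeasure_mono) (auto simp: Z_def circle_frac_circle_of frac_eq)
  with N(2) have "emeasure M Z = 0" using Z by (simp add: M)
  then have "Z \<in> null_sets M" using Z by (simp add: M_def null_sets_def)
  moreover have "- B \<subseteq> Z"
  proof
    fix c assume "c \<in> - B"
    then have "circle_of (circle_frac c) \<notin> B" by simp
    then show "c \<in> Z" using N(1) circle_frac_bounds[of c] unfolding Z_def by blast
  qed
  ultimately have null: "- B \<in> null_sets (completion M)"
    by (metis completion.complete2 null_sets_completionI)
  have space: "space (completion M) = UNIV" by (simp add: M_def)
  then have "B \<in> sets (completion M)"
    using null by (metis Compl_eq_Diff_UNIV double_complement null_setsD2 sets.compl_sets)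
  then have "emeasure (completion M) B = emeasure (completion M) (space (completion M))"
    using null space sets.top[of "completion M"] by (intro emeasure_eq_AE AE_I'[OF null]) auto
  also have "\<dots> = emeasure M UNIV" using space by (simp add: M_def)
  also have "\<dots> = 1" by (simp add: M)
  finally show ?thesis by (simp add: lebesgue_circle_def M_def)
qed

section \<open>The basin of a Dirac measure\<close>

text \<open>
  It suffices to control the orbit outside the one-sided neighbourhoods $[0,\varepsilon)$: on them a
  continuous test function is close to its value at $0$, and elsewhere it is bounded while the
  times spent there have density $0$.
\<close>

lemma dirac_basin_circleI:
  fixes f :: "circle \<Rightarrow> circle"
  assumes far: "\<And>e. 0 < e \<Longrightarrow>
    (\<lambda>n. real (card {i \<in> {..<n}. e \<le> circle_frac ((f ^^ i) x)}) / real n) \<longlonglongrightarrow> 0"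
  shows "x \<in> basin f (return borel (circle_of 0))"
  unfolding basin_def converges_weakly_def
proof (clarify)
  fix \<phi> :: "circle \<Rightarrow> real"
  assume cont: "continuous_on UNIV \<phi>" and bdd: "bounded (range \<phi>)"
  have meas: "\<phi> \<in> borel_measurable borel" by (rule borel_measurable_continuous_onI[OF cont])
  obtain B where B: "\<bar>\<phi> c\<bar> \<le> B" for c
    using bdd by (auto simp: bounded_iff)
  have int: "integral\<^sup>L (empirical_measure f x n) \<phi> = (\<Sum>i<n. \<phi> ((f ^^ i) x)) / real n" for n
    unfolding empirical_measure_def
    by (subst integral_distr[OF _ meas])
      (auto simp: integral_uniform_count_measure measurable_def space_uniform_count_measure
        sets_uniform_count_measure)
  have ret: "integral\<^sup>L (return borel (circle_of 0)) \<phi> = \<phi> (circle_of 0)"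
    by (rule integral_return) (simp_all add: meas)
  show "(\<lambda>n. integral\<^sup>L (empirical_measure f x n) \<phi>)
      \<longlonglongrightarrow> integral\<^sup>L (return borel (circle_of 0)) \<phi>"
    unfolding int ret
  proof (rule LIMSEQ_I)
    fix r :: real assume r: "0 < r"
    have "isCont (\<lambda>t. \<phi> (circle_of t)) 0"
      using continuous_on_compose[OF continuous_on_circle_of continuous_on_subset[OF cont]]
      by (simp add: continuous_on_eq_continuous_at o_def)
    then have "\<exists>e>0. \<forall>t. norm (t - 0) < e \<longrightarrow>
        norm (\<phi> (circle_of t) - \<phi> (circle_of 0)) < r / 2"
      using r half_gt_zero[OF r] unfolding continuous_at_eps_delta dist_norm by blast
    then obtain e where e: "0 < e"
      "\<And>t. \<bar>t\<bar> < e \<Longrightarrow> \<bar>\<phi> (circle_of t) - \<phi> (circle_of 0)\<bar> < r / 2"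
      by auto
    define C where "C n = {i \<in> {..<n}. e \<le> circle_frac ((f ^^ i) x)}" for n
    have "0 < r / (4 * (B + 1))" using r B[of "circle_of 0"] by (intro divide_pos_pos) auto
    then obtain n0 where n0: "\<And>n. n0 \<le> n \<Longrightarrow> real (card (C n)) / real n < r / (4 * (B + 1))"
      using LIMSEQ_D[OF far[OF e(1)]] unfolding C_def by fastforce
    have "norm ((\<Sum>i<n. \<phi> ((f ^^ i) x)) / real n - \<phi> (circle_of 0)) < r" if n: "max 1 n0 \<le> n" for n
    proof -
      have "0 < n" using n by simp
      have summand: "\<bar>\<phi> ((f ^^ i) x) - \<phi> (circle_of 0)\<bar> \<le> r / 2 + (if i \<in> C n then 2 * B else 0)"
        if "i < n" for i
      proof (cases "i \<in> C n")
        case True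
        then show ?thesis using B[of "(f ^^ i) x"] B[of "circle_of 0"] r by simp
      next
        case False
        then have "\<bar>circle_frac ((f ^^ i) x)\<bar> < e"
          using that circle_frac_bounds(1)[of "(f ^^ i) x"] by (simp add: C_def)
        from e(2)[OF this] False show ?thesis by simp
      qed
      have "(\<Sum>i<n. \<phi> ((f ^^ i) x)) / real n - \<phi> (circle_of 0)
          = (\<Sum>i<n. \<phi> ((f ^^ i) x) - \<phi> (circle_of 0)) / real n"
        using \<open>0 < n\<close> by (simp add: sum_subtractf field_simps)
      also have "norm \<dots> = \<bar>\<Sum>i<n. \<phi> ((f ^^ i) x) - \<phi> (circle_of 0)\<bar> / real n"
        by simp
      also have "\<dots> \<le> (\<Sum>i<n. r / 2 + (if i \<in> C n then 2 * B else 0)) / real n"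
        by (intro divide_right_mono order_trans[OF sum_abs] sum_mono summand) auto
      also have "(\<Sum>i<n. r / 2 + (if i \<in> C n then 2 * B else 0)) = real n * (r / 2) + real (card (C n)) * (2 * B)"
      proof -
        have "{..<n} \<inter> C n = C n" by (auto simp: C_def)
        then have "(\<Sum>i<n. if i \<in> C n then 2 * B else 0) = real (card (C n)) * (2 * B)"
          by (simp add: sum.If_cases)
        then show ?thesis by (simp only: sum.distrib) simp
      qed
      also have "\<dots> / real n = r / 2 + 2 * B * (real (card (C n)) / real n)"
        using \<open>0 < n\<close> by (simp add: field_simps)
      also have "\<dots> < r"
      proof -
        have "0 \<le> B" using B[of "circle_of 0"] by linarith
        then have "2 * B * (real (card (C n)) / real n) \<le> 2 * B * (r / (4 * (B + 1)))"
          using n0[of n] n by (intro mult_left_mono) auto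
        also have "\<dots> < r / 2" using r \<open>0 \<le> B\<close> by (simp add: field_simps)
        finally show ?thesis by simp
      qed
      finally show ?thesis .
    qed
    then show "\<exists>n0. \<forall>n\<ge>n0. norm ((\<Sum>i<n. \<phi> ((f ^^ i) x)) / real n - \<phi> (circle_of 0)) < r"
      by blast
  qed
qed

section \<open>Lifts with two convex branches\<close>

text \<open>
  \<open>F\<close> lifts a degree two circle map that fixes $0$, with branches $[0,q]$ and $[q,1]$. Convexity of
  the branches is stated as concavity of the inverse, since the intervals of the Markov partitions
  are images of integer intervals under iterates of \<open>G\<close>.
\<close>

locale convex_doubling_lift =
  fixes F G :: "real \<Rightarrow> real" and q lam :: real
  assumes F_G [simp]: "F (G y) = y" and G_F [simp]: "G (F x) = x"
    and mono_F: "strict_mono F"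
    and F_plus_one: "F (x + 1) = F x + 2" and F_0 [simp]: "F 0 = 0" and F_q [simp]: "F q = 1"
    and q: "0 < q" "q < 1"
    and concave_left: "concave_on {0..1} G" and concave_right: "concave_on {1..2} G"
    and lam: "1 < lam" and growth: "0 \<le> x \<Longrightarrow> x \<le> q \<Longrightarrow> lam * x \<le> F x"
begin

lemma surj_F: "surj F"
  by (metis F_G surjI)

lemma F_less_iff [simp]: "F x < F y \<longleftrightarrow> x < y"
  by (rule strict_mono_less[OF mono_F])

lemma F_le_iff [simp]: "F x \<le> F y \<longleftrightarrow> x \<le> y"
  by (rule strict_mono_less_eq[OF mono_F])

lemma G_less_iff [simp]: "G x < G y \<longleftrightarrow> x < y"
  by (metis F_G F_less_iff)

lemma G_le_iff [simp]: "G x \<le> G y \<longleftrightarrow> x \<le> y"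
  by (metis F_G F_le_iff)

lemma F_add_int: "F (x + of_int m) = F x + 2 * of_int m"
  using lift_add_int[of F 2 x m] F_plus_one by simp

lemma F_int [simp]: "F (of_int m) = 2 * of_int m"
  using F_add_int[of 0 m] by simp

lemma G_add_even: "G (y + 2 * of_int m) = G y + of_int m"
  by (metis F_G G_F F_add_int)

lemma G_0 [simp]: "G 0 = 0" and G_1 [simp]: "G 1 = q" and G_2 [simp]: "G 2 = 1"
  using G_F[of 0] G_F[of q] G_F[of 1] F_int[of 1] by (simp_all del: G_F)

lemma Fn_Gn [simp]: "(F ^^ n) ((G ^^ n) y) = y"
  by (induction n arbitrary: y) (simp_all add: funpow_swap1)

lemma Gn_Fn [simp]: "(G ^^ n) ((F ^^ n) x) = x"
  by (induction n arbitrary: x) (simp_all add: funpow_swap1)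

lemma Fn_less_iff [simp]: "(F ^^ n) x < (F ^^ n) y \<longleftrightarrow> x < y"
  by (induction n) simp_all

lemma Fn_le_iff [simp]: "(F ^^ n) x \<le> (F ^^ n) y \<longleftrightarrow> x \<le> y"
  by (induction n) simp_all

lemma Gn_less_iff [simp]: "(G ^^ n) x < (G ^^ n) y \<longleftrightarrow> x < y"
  by (induction n) simp_all

lemma Gn_le_iff [simp]: "(G ^^ n) x \<le> (G ^^ n) y \<longleftrightarrow> x \<le> y"
  by (induction n) simp_all

lemma Fn_add_int: "(F ^^ n) (x + of_int m) = (F ^^ n) x + of_int (2 ^ n * m)"
proof (induction n)
  case (Suc n)
  then show ?case by (simp only: funpow.simps comp_apply F_add_int) simp
qed simp

lemma Gn_add_int: "(G ^^ n) (y + of_int (2 ^ n * m)) = (G ^^ n) y + of_int m"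
  by (metis Fn_Gn Gn_Fn Fn_add_int)

lemma Fn_int: "(F ^^ n) (of_int m) = of_int (2 ^ n * m)"
proof -
  have "(F ^^ n) 0 = 0" by (induction n) simp_all
  then show ?thesis using Fn_add_int[of n 0 m] by simp
qed

lemma Gn_int: "(G ^^ n) (of_int (2 ^ n * m)) = of_int m"
  by (metis Fn_int Gn_Fn)

lemma continuous_Fn: "continuous_on UNIV (F ^^ n)"
  by (rule continuous_strict_mono_surj) (simp_all add: strict_mono_def surjI[of _ "G ^^ n"])

lemma measurable_Fn [measurable]: "F ^^ n \<in> borel_measurable borel"
  by (rule borel_measurable_continuous_onI[OF continuous_Fn])

lemma G_bounds:
  assumes "of_int m \<le> y" "y \<le> of_int m + 1"
  shows "of_int (m div 2) \<le> G y" "G y \<le> of_int (m div 2) + 1"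
proof -
  have *: "2 * real_of_int (m div 2) \<le> of_int m" "real_of_int m + 1 \<le> 2 * real_of_int (m div 2) + 2"
    by linarith+
  have "G (0 + 2 * of_int (m div 2)) \<le> G y" "G y \<le> G (2 + 2 * of_int (m div 2))"
    using assms * by simp_all
  then show "of_int (m div 2) \<le> G y" "G y \<le> of_int (m div 2) + 1"
    unfolding G_add_even by simp_all
qed

lemma concave_G: "concave_on {of_int m..of_int m + 1} G"
proof -
  define k where "k = m div 2"
  define b where "b = (if even m then 0 else 1 :: real)"
  have m: "of_int m = b + 2 * of_int k"
    unfolding k_def b_def by (auto elim!: evenE oddE)
  have conc: "concave_on {b..b + 1} G"
    using concave_left concave_right by (simp add: b_def)
  show ?thesis
    unfolding concave_on_iff
  proof (intro conjI ballI allI impI)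
    fix x y u v :: real
    assume x: "x \<in> {of_int m..of_int m + 1}" and y: "y \<in> {of_int m..of_int m + 1}"
      and uv: "u \<ge> 0" "v \<ge> 0" "u + v = 1"
    define x' where "x' = x - 2 * of_int k"
    define y' where "y' = y - 2 * of_int k"
    have xy: "x = x' + 2 * of_int k" "y = y' + 2 * of_int k"
      by (simp_all add: x'_def y'_def)
    have "u *\<^sub>R x + v *\<^sub>R y = (u *\<^sub>R x' + v *\<^sub>R y') + (u + v) * (2 * of_int k)"
      by (simp add: xy algebra_simps)
    then have "G (u *\<^sub>R x + v *\<^sub>R y) = G (u *\<^sub>R x' + v *\<^sub>R y') + of_int k"
      using uv(3) by (simp add: G_add_even)
    moreover have "u * G x' + v * G y' \<le> G (u *\<^sub>R x' + v *\<^sub>R y')"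
      using conc x y uv by (auto simp: concave_on_iff m xy)
    moreover have "u * G x + v * G y = u * G x' + v * G y' + (u + v) * of_int k"
      by (simp only: xy G_add_even) (simp add: algebra_simps)
    ultimately show "u * G x + v * G y \<le> G (u *\<^sub>R x + v *\<^sub>R y)"
      using uv(3) by simp
  qed simp
qed

text \<open>
  \<open>G\<close> maps each integer interval into an integer interval, so all iterates involve one branch at a
  time, and a composition of increasing concave functions is concave.
\<close>

lemma concave_Gn: "concave_on {of_int m..of_int m + 1} (G ^^ n)"
proof (induction n arbitrary: m)
  case 0
  show ?case by (auto simp: concave_on_iff)
next
  case (Suc n)
  show ?case
    unfolding concave_on_iff
  proof (intro conjI ballI allI impI)
    fix x y u v :: real
    assume x: "x \<in> {of_int m..of_int m + 1}" and y: "y \<in> {of_int m..of_int m + 1}"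
      and uv: "u \<ge> 0" "v \<ge> 0" "u + v = 1"
    have G: "G x \<in> {of_int (m div 2)..of_int (m div 2) + 1}"
      "G y \<in> {of_int (m div 2)..of_int (m div 2) + 1}"
      using G_bounds x y by auto
    have "u * (G ^^ n) (G x) + v * (G ^^ n) (G y) \<le> (G ^^ n) (u *\<^sub>R G x + v *\<^sub>R G y)"
      using Suc.IH[of "m div 2"] G uv unfolding concave_on_iff by blast
    also have "\<dots> \<le> (G ^^ n) (G (u *\<^sub>R x + v *\<^sub>R y))"
      using concave_G[of m] x y uv unfolding concave_on_iff by auto
    finally show "u * (G ^^ Suc n) x + v * (G ^^ Suc n) y \<le> (G ^^ Suc n) (u *\<^sub>R x + v *\<^sub>R y)"
      by (simp only: funpow_Suc_right comp_apply)
  qed simp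
qed

lemma Gn_chord:
  assumes "of_int m \<le> a" "a \<le> b" "b \<le> of_int m + 1" "0 \<le> s" "s \<le> 1"
  shows "s * ((G ^^ n) b - (G ^^ n) a) \<le> (G ^^ n) (a + s * (b - a)) - (G ^^ n) a"
proof -
  have *: "u * (G ^^ n) x + v * (G ^^ n) y \<le> (G ^^ n) (u *\<^sub>R x + v *\<^sub>R y)"
    if "x \<in> {of_int m..of_int m + 1}" "y \<in> {of_int m..of_int m + 1}" "0 \<le> u" "0 \<le> v" "u + v = 1"
    for x y u v
    using concave_Gn[of m n] that unfolding concave_on_iff by blast
  have "(1 - s) * (G ^^ n) a + s * (G ^^ n) b \<le> (G ^^ n) ((1 - s) *\<^sub>R a + s *\<^sub>R b)"
    using assms by (intro *) auto
  also have "(1 - s) *\<^sub>R a + s *\<^sub>R b = a + s * (b - a)" by (simp add: algebra_simps)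
  finally show ?thesis by (simp add: algebra_simps)
qed

text \<open>
  The integer \<open>m\<close> names an itinerary of length \<open>n\<close>: the binary digits of \<open>m\<close> tell the branches
  visited, and \<open>len n m\<close> is the length of the interval of points that follow it.
\<close>

definition len :: "nat \<Rightarrow> int \<Rightarrow> real"
  where "len n m = (G ^^ n) (of_int m + 1) - (G ^^ n) (of_int m)"

lemma len_nonneg: "0 \<le> len n m"
  by (simp add: len_def)

lemma G_double: "G (2 * of_int m) = of_int m" "G (2 * of_int m + 1) = of_int m + q"
  "G (2 * of_int m + 2) = of_int m + 1"
  using G_add_even[of 0 m] G_add_even[of 1 m] G_add_even[of 2 m] by (simp_all add: add.commute)

lemma len_even: "len (Suc n) (2 * m) = (G ^^ n) (of_int m + q) - (G ^^ n) (of_int m)"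
  and len_odd: "len (Suc n) (2 * m + 1) = (G ^^ n) (of_int m + 1) - (G ^^ n) (of_int m + q)"
  by (simp_all add: len_def G_double add.assoc funpow_Suc_right del: funpow.simps)

lemma len_split: "len n m = len (Suc n) (2 * m) + len (Suc n) (2 * m + 1)"
  unfolding len_even len_odd by (simp add: len_def)

text \<open>
  By concavity the left part $[m, m+q]$ of an integer interval takes up at least the fraction $q$ of
  the image under \<open>G ^^ n\<close>.
\<close>

lemma len_odd_le: "len (Suc n) (2 * m + 1) \<le> (1 - q) * len n m"
proof -
  have "q * len n m \<le> len (Suc n) (2 * m)"
    using Gn_chord[of m "of_int m" "of_int m + 1" q n] q unfolding len_even by (simp add: len_def)
  then show ?thesis using len_split[of n m] by (simp add: algebra_simps)
qed

lemma q_power_le_Gn: "q ^ n \<le> (G ^^ n) 1"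
proof (induction n)
  case (Suc n)
  have "0 \<le> (G ^^ n) 1"
    using Gn_le_iff[of n 0 1] Gn_int[of n 0] by (simp del: Gn_le_iff)
  moreover have "(G ^^ n) 1 \<le> 1"
  proof -
    have "(G ^^ n) 1 \<le> (G ^^ n) (of_int (2 ^ n * 1))" by simp
    then show ?thesis by (simp only: Gn_int)
  qed
  ultimately have "(G ^^ n) 1 * q \<le> G ((G ^^ n) 1)"
    using Gn_chord[of 0 0 1 "(G ^^ n) 1" 1] by simp
  moreover have "q ^ Suc n \<le> (G ^^ n) 1 * q" using Suc.IH q by simp
  ultimately show ?case by simp
qed simp

text \<open>
  A point between $q$ and $q +$ \<open>trap N\<close> is mapped by \<open>F\<close>, modulo $1$, below $q^N$ and from there
  makes \<open>N\<close> steps in the left branch.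
\<close>

definition trap :: "nat \<Rightarrow> real" where "trap N = G (1 + q ^ N) - q"

lemma trap_bounds: "0 \<le> trap N" "trap N \<le> 1 - q"
proof -
  have "q ^ N \<le> 1" using q by (simp add: power_le_one)
  then have "G 1 \<le> G (1 + q ^ N)" "G (1 + q ^ N) \<le> G 2" unfolding G_le_iff using q by simp_all
  then show "0 \<le> trap N" "trap N \<le> 1 - q" by (simp_all add: trap_def)
qed

text \<open>
  An odd \<open>m\<close> means that the last digit is a visit to the right branch, and the digits of $2^N m$
  continue with \<open>N\<close> visits to the left one. The trap occupies at least the fraction
  \<open>trap N\<close> of $[q,1]$, and it sits at its left end, so a concave image of it occupies at least that
  fraction of the image of $[q,1]$. This is the only estimate on lengths that the measure
  theoretic argument uses.
\<close>

lemma trap_le_len: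
  assumes "odd m"
  shows "trap N * len (Suc n) m \<le> len (Suc n + N) (2 ^ N * m)"
proof -
  obtain k where k: "m = 2 * k + 1" using assms by (elim oddE)
  have "q ^ N \<le> (G ^^ N) 1" by (rule q_power_le_Gn)
  then have "G (1 + q ^ N) \<le> G (1 + (G ^^ N) 1)" by simp
  moreover have "G (of_int m + (G ^^ N) 1) = of_int k + G (1 + (G ^^ N) 1)"
    using G_add_even[of "1 + (G ^^ N) 1" k] by (simp add: k algebra_simps)
  ultimately have "of_int k + q + trap N \<le> G (of_int m + (G ^^ N) 1)"
    by (simp add: trap_def)
  then have *: "(G ^^ n) (of_int k + q + trap N) \<le> (G ^^ n) (G (of_int m + (G ^^ N) 1))"
    by (simp only: Gn_le_iff)
  have "(G ^^ N) (1 + of_int (2 ^ N * m)) = of_int m + (G ^^ N) 1"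
    using Gn_add_int[of N 1 m] by simp
  moreover have "(G ^^ N) (of_int (2 ^ N * m)) = of_int m" by (rule Gn_int)
  moreover have "G (of_int m) = of_int k + q" by (simp add: k G_double)
  ultimately have len: "len (Suc n + N) (2 ^ N * m) =
      (G ^^ n) (G (of_int m + (G ^^ N) 1)) - (G ^^ n) (of_int k + q)"
    unfolding len_def funpow_add funpow_Suc_right comp_apply by (simp only: add.commute[of _ 1])
  define s where "s = trap N / (1 - q)"
  have s: "0 \<le> s" "s \<le> 1" "s * (1 - q) = trap N" "trap N \<le> s"
    using trap_bounds[of N] q by (auto simp: s_def field_simps)
  have "trap N * len (Suc n) m \<le> s * len (Suc n) m"
    using s by (intro mult_right_mono len_nonneg)
  also have len': "len (Suc n) m = (G ^^ n) (of_int k + 1) - (G ^^ n) (of_int k + q)"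
    unfolding k by (rule len_odd)
  also have "s * \<dots> \<le> (G ^^ n) (of_int k + q + s * (of_int k + 1 - (of_int k + q))) - (G ^^ n) (of_int k + q)"
    using s q by (intro Gn_chord[of k]) auto
  also have "of_int k + q + s * (of_int k + 1 - (of_int k + q)) = of_int k + q + trap N"
    using s(3) by simp
  finally show ?thesis using * unfolding len len' by linarith
qed

subsection \<open>Expansiveness and the conjugacy to doubling\<close>

lemma floor_F: "\<lfloor>F x\<rfloor> = 2 * \<lfloor>x\<rfloor> + (if q \<le> frac x then 1 else 0)"
proof -
  have F: "F x = F (frac x) + of_int (2 * \<lfloor>x\<rfloor>)"
    using F_add_int[of "frac x" "\<lfloor>x\<rfloor>"] by (simp add: frac_def)
  have "F 0 \<le> F (frac x)" "F (frac x) < F 1"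
    unfolding F_le_iff F_less_iff by (simp_all add: frac_lt_1)
  then have bounds: "0 \<le> F (frac x)" "F (frac x) < 2"
    using F_int[of 1] by (simp_all del: F_less_iff)
  have "q \<le> frac x \<longleftrightarrow> 1 \<le> F (frac x)"
    using F_le_iff[of q "frac x"] by simp
  then show ?thesis
    using bounds F by (intro floor_unique) auto
qed

lemma frac_F_ge:
  assumes "even \<lfloor>F x\<rfloor>"
  shows "lam * frac x \<le> frac (F x)"
proof -
  have x: "frac x < q" using assms by (auto simp: floor_F split: if_splits)
  have "F x = F (frac x) + of_int (2 * \<lfloor>x\<rfloor>)"
    using F_add_int[of "frac x" "\<lfloor>x\<rfloor>"] by (simp add: frac_def)
  moreover have "\<lfloor>F x\<rfloor> = 2 * \<lfloor>x\<rfloor>" using x by (simp add: floor_F)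
  ultimately have "frac (F x) = F (frac x)" by (simp add: frac_def)
  then show ?thesis using growth[of "frac x"] x by simp
qed

lemma frac_Fn_ge:
  assumes "\<And>i. n < i \<Longrightarrow> i \<le> n + M \<Longrightarrow> even \<lfloor>(F ^^ i) x\<rfloor>"
  shows "lam ^ M * frac ((F ^^ n) x) \<le> frac ((F ^^ (n + M)) x)"
  using assms
proof (induction M)
  case (Suc M)
  have "lam ^ Suc M * frac ((F ^^ n) x) = lam * (lam ^ M * frac ((F ^^ n) x))" by simp
  also have "\<dots> \<le> lam * frac ((F ^^ (n + M)) x)" using Suc lam by (intro mult_left_mono) auto
  also have "\<dots> \<le> frac ((F ^^ (n + Suc M)) x)"
    using Suc.prems[of "n + Suc M"] by (simp add: frac_F_ge)
  finally show ?case .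
qed simp

lemma ex_lam_power_gt:
  assumes "0 < e"
  shows "\<exists>M. 1 < lam ^ M * e"
  using real_arch_pow[OF lam, of "1 / e"] assms by (auto simp: field_simps)

text \<open>
  The floor of $F^i x$ is odd exactly when $F^{i-1} x$ lies in the right branch modulo $1$.
\<close>

definition visits :: "real \<Rightarrow> nat \<Rightarrow> nat \<Rightarrow> nat"
  where "visits x m n = card {i \<in> {m<..n}. odd \<lfloor>(F ^^ i) x\<rfloor>}"

lemma len_le_visits: "len n \<lfloor>(F ^^ n) x\<rfloor> \<le> (1 - q) ^ visits x 0 n"
proof (induction n)
  case 0
  show ?case by (simp add: len_def visits_def)
next
  case (Suc n)
  let ?m = "\<lfloor>(F ^^ n) x\<rfloor>"
  have ivl: "{i \<in> {0<..Suc n}. odd \<lfloor>(F ^^ i) x\<rfloor>} =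
    (if odd \<lfloor>(F ^^ Suc n) x\<rfloor> then insert (Suc n) else id) {i \<in> {0<..n}. odd \<lfloor>(F ^^ i) x\<rfloor>}"
    by (auto simp: le_Suc_eq simp del: funpow.simps)
  show ?case
  proof (cases "q \<le> frac ((F ^^ n) x)")
    case True
    then have "\<lfloor>(F ^^ Suc n) x\<rfloor> = 2 * ?m + 1" by (simp add: floor_F)
    moreover from this have "visits x 0 (Suc n) = Suc (visits x 0 n)"
      unfolding visits_def ivl by simp
    moreover have "len (Suc n) (2 * ?m + 1) \<le> (1 - q) * (1 - q) ^ visits x 0 n"
      using len_odd_le[of n ?m] q by (intro order_trans[OF len_odd_le] mult_left_mono Suc) auto
    ultimately show ?thesis by (simp del: funpow.simps)
  next
    case False
    then have "\<lfloor>(F ^^ Suc n) x\<rfloor> = 2 * ?m" by (simp add: floor_F)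
    moreover from this have "visits x 0 (Suc n) = visits x 0 n"
      unfolding visits_def ivl by simp
    moreover have "len (Suc n) (2 * ?m) \<le> (1 - q) ^ visits x 0 n"
      using len_split[of n ?m] len_nonneg[of "Suc n" "2 * ?m + 1"] Suc by linarith
    ultimately show ?thesis by (simp del: funpow.simps)
  qed
qed

lemma ex_Fn_ge_1:
  assumes "0 < s"
  shows "\<exists>j. 1 \<le> (F ^^ j) s"
proof -
  obtain M where M: "1 < lam ^ M * s" using ex_lam_power_gt[OF assms] by blast
  have pos: "0 \<le> (F ^^ j) s" for j
    using Fn_less_iff[of j 0 s] assms Fn_int[of j 0] by (simp del: Fn_less_iff)
  have "\<exists>j. q \<le> (F ^^ j) s"
  proof (rule ccontr)
    assume "\<not> ?thesis"
    then have less: "(F ^^ j) s < q" for j by (simp add: not_le)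
    have "lam ^ j * s \<le> (F ^^ j) s" for j
    proof (induction j)
      case (Suc j)
      have "lam ^ Suc j * s \<le> lam * (F ^^ j) s" using Suc lam by simp
      also have "\<dots> \<le> F ((F ^^ j) s)" using growth pos less less_imp_le by blast
      finally show ?case by simp
    qed simp
    from this[of M] less[of M] M q show False by linarith
  qed
  then obtain j where "q \<le> (F ^^ j) s" by blast
  then have "F q \<le> F ((F ^^ j) s)" by (simp only: F_le_iff)
  then show ?thesis by (intro exI[of _ "Suc j"]) simp
qed

text \<open>
  To the right of an integer, distances grow at least by the factor \<open>lam\<close> until they reach $q$, and one more
  step makes them at least $1$.
\<close>

lemma expansive_from_int:
  assumes "(F ^^ n) x = of_int m" "x < y"
  shows "\<exists>n. (F ^^ n) x + 1 \<le> (F ^^ n) y"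
proof -
  define s where "s = (F ^^ n) y - of_int m"
  have "(F ^^ n) x < (F ^^ n) y" using assms(2) by simp
  with assms(1) have "0 < s" by (simp add: s_def)
  then obtain j where j: "1 \<le> (F ^^ j) s" using ex_Fn_ge_1 by blast
  have "(F ^^ (j + n)) y = (F ^^ j) s + of_int (2 ^ j * m)"
    using Fn_add_int[of j s m] by (simp add: funpow_add s_def)
  moreover have "(F ^^ (j + n)) x = of_int (2 ^ j * m)"
    using assms(1) Fn_int[of j m] by (simp add: funpow_add)
  ultimately show ?thesis using j by (intro exI[of _ "j + n"]) simp
qed

text \<open>
  If the itinerary of \<open>x\<close> visits the right branch only finitely often, then the geometric growth in
  the left branch forces the orbit of \<open>x\<close> onto an integer. Otherwise the intervals around \<open>x\<close> shrink
  to it, and some right end point \<open>z\<close> of one of them, whose orbit reaches an integer, separates \<open>x\<close>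
  from \<open>y\<close>. In both cases growth to the right of an integer finishes the argument.
\<close>

lemma expansive:
  assumes "x < y"
  shows "\<exists>n. (F ^^ n) x + 1 \<le> (F ^^ n) y"
proof (cases "finite {i. odd \<lfloor>(F ^^ i) x\<rfloor>}")
  case True
  then obtain n where "\<forall>i. odd \<lfloor>(F ^^ i) x\<rfloor> \<longrightarrow> i < n"
    unfolding finite_nat_set_iff_bounded by auto
  then have n: "even \<lfloor>(F ^^ i) x\<rfloor>" if "n < i" for i
    using that by (meson less_asym)
  have "frac ((F ^^ n) x) = 0"
  proof (rule ccontr)
    assume "frac ((F ^^ n) x) \<noteq> 0"
    then have "0 < frac ((F ^^ n) x)" using frac_ge_0[of "(F ^^ n) x"] by linarith
    then obtain M where "1 < lam ^ M * frac ((F ^^ n) x)" using ex_lam_power_gt by blast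
    moreover have "lam ^ M * frac ((F ^^ n) x) \<le> frac ((F ^^ (n + M)) x)"
      by (rule frac_Fn_ge) (rule n)
    ultimately show False using frac_lt_1[of "(F ^^ (n + M)) x"] by linarith
  qed
  then have "(F ^^ n) x = of_int \<lfloor>(F ^^ n) x\<rfloor>" by (simp add: frac_def)
  then show ?thesis using expansive_from_int assms by blast
next
  case False
  obtain k where k: "(1 - q) ^ k < y - x"
    using real_arch_pow_inv[of "y - x" "1 - q"] assms q by auto
  obtain T where T: "T \<subseteq> {i. odd \<lfloor>(F ^^ i) x\<rfloor>} - {0}" "card T = k" "finite T"
    using infinite_arbitrarily_large[of "{i. odd \<lfloor>(F ^^ i) x\<rfloor>} - {0}" k] False by auto
  define n where "n = Max (insert 0 T)"
  have "T \<subseteq> {i \<in> {0<..n}. odd \<lfloor>(F ^^ i) x\<rfloor>}"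
    using T by (auto simp: n_def)
  then have "k \<le> visits x 0 n"
    unfolding visits_def T(2)[symmetric] by (intro card_mono) auto
  then have "(1 - q) ^ visits x 0 n \<le> (1 - q) ^ k" using q by (intro power_decreasing) auto
  then have len: "len n \<lfloor>(F ^^ n) x\<rfloor> < y - x" using k len_le_visits[of n x] by linarith
  define z where "z = (G ^^ n) (of_int \<lfloor>(F ^^ n) x\<rfloor> + 1)"
  have "(G ^^ n) (of_int \<lfloor>(F ^^ n) x\<rfloor>) \<le> (G ^^ n) ((F ^^ n) x)"
    "(G ^^ n) ((F ^^ n) x) < z"
    unfolding z_def Gn_le_iff Gn_less_iff by linarith+
  then have z: "x < z" "z < y" using len by (auto simp: len_def z_def)
  have "(F ^^ n) z = of_int (\<lfloor>(F ^^ n) x\<rfloor> + 1)" by (simp add: z_def)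
  then obtain j where "(F ^^ j) z + 1 \<le> (F ^^ j) y" using expansive_from_int z(2) by blast
  moreover have "(F ^^ j) x < (F ^^ j) z" using z(1) by simp
  ultimately show ?thesis by (intro exI[of _ j]) linarith
qed

lemma F_minus_double_le: "\<bar>F x - 2 * x\<bar> \<le> 2"
proof -
  have "F (of_int \<lfloor>x\<rfloor>) \<le> F x" "F x \<le> F (of_int (\<lfloor>x\<rfloor> + 1))"
    unfolding F_le_iff by linarith+
  then show ?thesis unfolding F_int by (simp add: abs_le_iff) linarith
qed

text \<open>
  Since $F x - 2x$ is bounded, $F^n x / 2^n$ converges uniformly, and its limit inherits monotonicity
  and the functional equations. Expansiveness makes it strictly monotone: two points whose orbits
  get $1$ apart are separated by \<open>h\<close>, as \<open>h\<close> commutes with the unit translation.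
\<close>

lemma conjugating_lift:
  obtains h :: "real \<Rightarrow> real"
  where "strict_mono h" "surj h" "\<And>x. h (x + 1) = h x + 1" "\<And>x. h (F x) = 2 * h x"
proof -
  define u where "u n x = (F ^^ n) x / 2 ^ n" for n x
  define h where "h x = x + (\<Sum>n. u (Suc n) x - u n x)" for x
  have bound: "norm (u (Suc n) x - u n x) \<le> (1 / 2) ^ n" for n x
  proof -
    have "u (Suc n) x - u n x = (F ((F ^^ n) x) - 2 * (F ^^ n) x) / (2 * 2 ^ n)"
      by (simp add: u_def field_simps)
    also have "norm \<dots> = \<bar>F ((F ^^ n) x) - 2 * (F ^^ n) x\<bar> / (2 * 2 ^ n)"
      by (simp add: abs_divide)
    also have "\<dots> \<le> 2 / (2 * 2 ^ n)"
      by (intro divide_right_mono F_minus_double_le) simp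
    finally show ?thesis by (simp add: power_one_over)
  qed
  have telescope: "(\<Sum>i<n. u (Suc i) x - u i x) = u n x - u 0 x" for n x
    using sum_lessThan_telescope[of "\<lambda>i. u i x"] by simp
  have "uniform_limit UNIV (\<lambda>n x. \<Sum>i<n. u (Suc i) x - u i x)
      (\<lambda>x. \<Sum>n. u (Suc n) x - u n x) sequentially"
    using bound by (intro Weierstrass_m_test[of _ _ "\<lambda>n. (1/2) ^ n"]) (auto simp: summable_geometric)
  then have "uniform_limit UNIV (\<lambda>n x. x + (u n x - u 0 x)) h sequentially"
    unfolding h_def telescope by (intro uniform_limit_add uniform_limit_const)
  moreover have "(\<lambda>n x. x + (u n x - u 0 x)) = u"
    by (simp add: u_def fun_eq_iff)
  ultimately have unif: "uniform_limit UNIV u h sequentially"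
    by simp
  have lim: "(\<lambda>n. u n x) \<longlonglongrightarrow> h x" for x
    using tendsto_uniform_limitI[OF unif] by simp
  have cont: "continuous_on UNIV h"
    using continuous_Fn
    by (intro uniform_limit_theorem[OF _ unif]) (auto simp: u_def intro!: always_eventually continuous_intros)
  have mono: "h x \<le> h y" if "x \<le> y" for x y
    using that by (intro LIMSEQ_le[OF lim lim]) (auto simp: u_def divide_right_mono)
  have shift: "h (x + 1) = h x + 1" for x
  proof -
    have "u n (x + 1) = u n x + 1" for n
      using Fn_add_int[of n x 1] by (simp add: u_def add_divide_distrib)
    then have "(\<lambda>n. u n x + 1) \<longlonglongrightarrow> h (x + 1)" using lim[of "x + 1"] by simp
    moreover have "(\<lambda>n. u n x + 1) \<longlonglongrightarrow> h x + 1" by (intro tendsto_intros lim)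
    ultimately show ?thesis by (rule LIMSEQ_unique)
  qed
  have conj: "h (F x) = 2 * h x" for x
  proof -
    have "u n (F x) = 2 * u (Suc n) x" for n
      by (simp add: u_def funpow_swap1)
    then have "(\<lambda>n. 2 * u (Suc n) x) \<longlonglongrightarrow> h (F x)" using lim[of "F x"] by simp
    moreover have "(\<lambda>n. 2 * u (Suc n) x) \<longlonglongrightarrow> 2 * h x"
      by (intro tendsto_intros LIMSEQ_Suc lim)
    ultimately show ?thesis by (rule LIMSEQ_unique)
  qed
  have conj_n: "h ((F ^^ n) x) = 2 ^ n * h x" for n x
    by (induction n) (simp_all add: conj)
  have "strict_mono h"
  proof (rule strict_monoI)
    fix x y :: real assume "x < y"
    then obtain n where "(F ^^ n) x + 1 \<le> (F ^^ n) y" using expansive by blast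
    then have "h ((F ^^ n) x) + 1 \<le> h ((F ^^ n) y)" using mono shift by metis
    then have "2 ^ n * h x < 2 ^ n * h y" unfolding conj_n by linarith
    then show "h x < h y" by simp
  qed
  moreover have "surj h"
  proof (rule surjI)
    fix y
    have int: "h (of_int m) = h 0 + of_int m" for m
      using lift_add_int[of h 1 0 m] shift by simp
    define m where "m = \<lfloor>y - h 0\<rfloor>"
    have "h (of_int m) \<le> y" "y \<le> h (of_int (m + 1))"
      unfolding int m_def by linarith+
    then have "\<exists>x. of_int m \<le> x \<and> x \<le> of_int (m + 1) \<and> h x = y"
      using cont by (intro IVT') (auto intro: continuous_on_subset)
    then show "h (SOME x. h x = y) = y" by (auto intro: someI)
  qed
  ultimately show ?thesis using that shift conj by blast
qed

subsection \<open>Frequency of the visits to the right branch\<close>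

lemma cylinder_eq: "{x. \<lfloor>(F ^^ n) x\<rfloor> = m} = {(G ^^ n) (of_int m)..<(G ^^ n) (of_int m + 1)}"
proof -
  have "(G ^^ n) (of_int m) \<le> x \<longleftrightarrow> of_int m \<le> (F ^^ n) x"
    "x < (G ^^ n) (of_int m + 1) \<longleftrightarrow> (F ^^ n) x < of_int m + 1" for x
    by (metis Gn_Fn Gn_le_iff) (metis Gn_Fn Gn_less_iff)
  then show ?thesis by (auto simp: floor_eq_iff)
qed

lemma emeasure_cylinder: "emeasure lborel {x. \<lfloor>(F ^^ n) x\<rfloor> = m} = len n m"
  unfolding cylinder_eq len_def by (simp add: emeasure_lborel_Ico)

definition busy :: "nat \<Rightarrow> int \<Rightarrow> nat \<Rightarrow> nat \<Rightarrow> real set"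
  where "busy N m k n = {x. \<lfloor>(F ^^ n) x\<rfloor> = m \<and> k \<le> visits x n (n + N)}"

lemma measurable_visits [measurable]: "(\<lambda>x. visits x m n) \<in> measurable borel (count_space UNIV)"
proof -
  have "visits x m n = (\<Sum>i\<in>{m<..n}. if odd \<lfloor>(F ^^ i) x\<rfloor> then 1 else 0)" for x
    unfolding visits_def by (simp add: sum.If_cases Int_def conj_commute)
  then show ?thesis by simp
qed

lemma sets_busy [measurable]: "busy N m k n \<in> sets borel"
  unfolding busy_def by measurable

text \<open>
  Split by the time \<open>n + Suc j\<close> of the first visit, before which all digits are $0$. The window of
  length \<open>N\<close> is restarted there; it then reaches beyond the old one, which only enlarges the set
  and makes the recursion uniform.
\<close>

lemma busy_Suc_subset:
  "busy N m (Suc k) n \<subseteq> (\<Union>j<N. busy N (2 ^ Suc j * m + 1) k (n + Suc j))"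
proof
  fix x assume x: "x \<in> busy N m (Suc k) n"
  define S where "S = {i \<in> {n<..n + N}. odd \<lfloor>(F ^^ i) x\<rfloor>}"
  have card: "Suc k \<le> card S" and m: "\<lfloor>(F ^^ n) x\<rfloor> = m"
    using x by (auto simp: busy_def visits_def S_def)
  have "finite S" by (simp add: S_def)
  have "S \<noteq> {}" using card by auto
  define i where "i = Min S"
  have i: "i \<in> S" and min: "\<And>l. l \<in> S \<Longrightarrow> i \<le> l"
    using \<open>finite S\<close> \<open>S \<noteq> {}\<close> by (auto simp: i_def)
  obtain j where j: "i = n + Suc j" "j < N"
    using i less_imp_add_positive[of n i] by (auto simp: S_def dest!: less_imp_Suc_add)
  have even: "\<lfloor>(F ^^ (n + l)) x\<rfloor> = 2 ^ l * m" if "l \<le> j" for l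
    using that
  proof (induction l)
    case (Suc l)
    have "n + Suc l \<notin> S" using min[of "n + Suc l"] Suc.prems j by auto
    then have "even \<lfloor>F ((F ^^ (n + l)) x)\<rfloor>" using Suc.prems j by (auto simp: S_def)
    then show ?case using Suc by (auto simp: floor_F split: if_splits)
  qed (simp add: m)
  have "odd \<lfloor>F ((F ^^ (n + j)) x)\<rfloor>" using i j by (simp add: S_def)
  then have "\<lfloor>(F ^^ (n + Suc j)) x\<rfloor> = 2 ^ Suc j * m + 1"
    using even[of j] by (auto simp: floor_F split: if_splits)
  moreover have "k \<le> visits x (n + Suc j) (n + Suc j + N)"
  proof -
    have "S - {i} \<subseteq> {l \<in> {n + Suc j<..n + Suc j + N}. odd \<lfloor>(F ^^ l) x\<rfloor>}"
    proof
      fix l assume "l \<in> S - {i}"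
      then have "l \<in> S" "i < l" using min[of l] by auto
      then show "l \<in> {l \<in> {n + Suc j<..n + Suc j + N}. odd \<lfloor>(F ^^ l) x\<rfloor>}"
        using j by (auto simp: S_def)
    qed
    then have "card (S - {i}) \<le> visits x (n + Suc j) (n + Suc j + N)"
      unfolding visits_def by (intro card_mono) auto
    then show ?thesis using card i \<open>finite S\<close> by (simp add: card_Diff_singleton)
  qed
  ultimately show "x \<in> (\<Union>j<N. busy N (2 ^ Suc j * m + 1) k (n + Suc j))"
    using j by (auto simp: busy_def)
qed

text \<open>
  The points of an interval that visit the right branch within \<open>N\<close> steps are those that do not
  continue with \<open>N\<close> zeros.
\<close>

lemma sum_len_first_visit:
  "(\<Sum>j<N. len (n + Suc j) (2 ^ Suc j * m + 1)) = len n m - len (n + N) (2 ^ N * m)"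
proof (induction N)
  case (Suc N)
  show ?case
    using Suc len_split[of "n + N" "2 ^ N * m"] by (simp add: mult.assoc)
qed simp

lemma emeasure_busy_Suc:
  assumes "\<And>j. emeasure lborel (busy N (2 ^ Suc j * m + 1) k (n + Suc j))
    \<le> ennreal ((1 - trap N) ^ k * len (n + Suc j) (2 ^ Suc j * m + 1))"
  shows "emeasure lborel (busy N m (Suc k) n)
    \<le> ennreal ((1 - trap N) ^ k * (len n m - len (n + N) (2 ^ N * m)))"
proof -
  have t: "0 \<le> 1 - trap N" using trap_bounds[of N] q by simp
  have "emeasure lborel (busy N m (Suc k) n)
      \<le> emeasure lborel (\<Union>j<N. busy N (2 ^ Suc j * m + 1) k (n + Suc j))"
    by (intro emeasure_mono busy_Suc_subset) auto
  also have "\<dots> \<le> (\<Sum>j<N. emeasure lborel (busy N (2 ^ Suc j * m + 1) k (n + Suc j)))"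
    by (intro emeasure_subadditive_finite) auto
  also have "\<dots> \<le> (\<Sum>j<N. ennreal ((1 - trap N) ^ k * len (n + Suc j) (2 ^ Suc j * m + 1)))"
    by (intro sum_mono assms)
  also have "\<dots> = ennreal (\<Sum>j<N. (1 - trap N) ^ k * len (n + Suc j) (2 ^ Suc j * m + 1))"
    using t by (intro sum_ennreal mult_nonneg_nonneg zero_le_power len_nonneg)
  also have "(\<Sum>j<N. (1 - trap N) ^ k * len (n + Suc j) (2 ^ Suc j * m + 1))
      = (1 - trap N) ^ k * (len n m - len (n + N) (2 ^ N * m))"
    by (simp only: sum_distrib_left[symmetric] sum_len_first_visit)
  finally show ?thesis .
qed

text \<open>
  For odd \<open>m\<close> the last step was a visit, so \<open>trap_le_len\<close> gives that the fraction \<open>trap N\<close> of the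
  interval has no further visit within \<open>N\<close> steps. Each additional visit therefore costs a factor
  $1 -$ \<open>trap N\<close>.
\<close>

lemma emeasure_busy:
  assumes "odd m" "0 < n"
  shows "emeasure lborel (busy N m k n) \<le> ennreal ((1 - trap N) ^ k * len n m)"
  using assms
proof (induction k arbitrary: m n)
  case 0
  have "emeasure lborel (busy N m 0 n) \<le> emeasure lborel {x. \<lfloor>(F ^^ n) x\<rfloor> = m}"
    by (intro emeasure_mono) (auto simp: busy_def)
  then show ?case by (simp add: emeasure_cylinder)
next
  case (Suc k)
  have t: "0 \<le> 1 - trap N" using trap_bounds[of N] q by simp
  have "emeasure lborel (busy N m (Suc k) n)
      \<le> ennreal ((1 - trap N) ^ k * (len n m - len (n + N) (2 ^ N * m)))"
    by (intro emeasure_busy_Suc Suc.IH) auto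
  also have "\<dots> \<le> ennreal ((1 - trap N) ^ k * ((1 - trap N) * len n m))"
  proof (intro ennreal_leI mult_left_mono zero_le_power t)
    obtain n' where "n = Suc n'" using Suc.prems gr0_implies_Suc by blast
    then show "len n m - len (n + N) (2 ^ N * m) \<le> (1 - trap N) * len n m"
      using trap_le_len[OF Suc.prems(1), of N n'] by (simp add: algebra_simps)
  qed
  finally show ?case by (simp add: mult.assoc mult.left_commute)
qed

text \<open>
  Time $0$ is not preceded by a visit, so the first visit costs no factor.
\<close>

lemma emeasure_busy_0:
  "emeasure lborel (busy N 0 (Suc k) 0) \<le> ennreal ((1 - trap N) ^ k)"
proof -
  have t: "0 \<le> 1 - trap N" using trap_bounds[of N] q by simp
  have "emeasure lborel (busy N 0 (Suc k) 0)
      \<le> ennreal ((1 - trap N) ^ k * (len 0 0 - len (0 + N) (2 ^ N * 0)))"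
    by (intro emeasure_busy_Suc emeasure_busy) auto
  also have "\<dots> \<le> ennreal ((1 - trap N) ^ k * 1)"
    using len_nonneg[of N 0]
    by (intro ennreal_leI mult_left_mono zero_le_power t) (simp add: len_def)
  finally show ?thesis by simp
qed

text \<open>
  A window of length $k^2$ balances the two requirements: at most $\sqrt n$ visits up to time
  $n$ have density $0$, while the exponent $k \cdot$ \<open>trap\<close>$(k^2) \ge c \sqrt k$ still tends to infinity
  fast enough for the Borel--Cantelli lemma.
\<close>

lemma AE_eventually_visits_le:
  assumes c: "0 < c" and tail: "\<And>k. 0 < k \<Longrightarrow> c / sqrt (real k) \<le> trap (k\<^sup>2)"
  shows "AE x in lborel. 0 \<le> x \<longrightarrow> x < 1 \<longrightarrow> (\<forall>\<^sub>F k in sequentially. visits x 0 (k\<^sup>2) \<le> k)"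
proof -
  define A where "A k = busy (k\<^sup>2) 0 (Suc k) 0" for k
  have em: "emeasure lborel (A k) \<le> ennreal ((1 - trap (k\<^sup>2)) ^ k)" for k
    unfolding A_def by (rule emeasure_busy_0)
  have fin: "emeasure lborel (A k) < \<infinity>" for k
    using em[of k] ennreal_less_top le_less_trans by (metis infinity_ennreal_def)
  have bound: "norm (measure lborel (A k)) \<le> 256 / c ^ 4 * (1 / real k ^ 2)" if "0 < k" for k
  proof -
    have t: "0 \<le> 1 - trap (k\<^sup>2)" using trap_bounds[of "k\<^sup>2"] q by simp
    define z where "z = c * sqrt (real k)"
    have z: "0 < z" using c that by (simp add: z_def)
    have "measure lborel (A k) \<le> (1 - trap (k\<^sup>2)) ^ k"
      using em[of k] t fin[of k] by (simp add: measure_def enn2real_leI)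
    also have "\<dots> \<le> exp (- trap (k\<^sup>2)) ^ k"
      using exp_ge_add_one_self[of "- trap (k\<^sup>2)"] t by (intro power_mono) auto
    also have "\<dots> = exp (- (real k * trap (k\<^sup>2)))"
      by (simp add: exp_of_nat_mult[symmetric])
    also have "\<dots> \<le> exp (- z)"
    proof -
      have "z = real k * (c / sqrt (real k))"
      proof -
        have "real k * (c / sqrt (real k)) = c * (real k / sqrt (real k))" by simp
        then show ?thesis by (simp only: real_div_sqrt[OF of_nat_0_le_iff] z_def)
      qed
      also have "\<dots> \<le> real k * trap (k\<^sup>2)" using tail[OF that] by (intro mult_left_mono) auto
      finally show ?thesis by simp
    qed
    also have "\<dots> \<le> 256 / z ^ 4"
    proof -
      \<comment> \<open>the fourth power turns the bound into one of order \<open>1 / k\<^sup>2\<close>\<close>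
      have "z / 4 \<le> exp (z / 4)" using exp_ge_add_one_self[of "z / 4"] by linarith
      then have "(z / 4) ^ 4 \<le> exp (z / 4) ^ 4"
        using z by (intro power_mono) simp_all
      also have "\<dots> = exp z" by (simp flip: exp_of_nat_mult)
      finally show ?thesis using z by (simp add: exp_minus field_simps)
    qed
    also have "z ^ 4 = c ^ 4 * real k ^ 2"
    proof -
      have "z ^ 4 = c ^ 4 * (sqrt (real k) ^ 2) ^ 2"
        unfolding z_def power_mult_distrib power_mult[symmetric] by simp
      then show ?thesis by simp
    qed
    finally show ?thesis by simp
  qed
  have "summable (\<lambda>k. 256 / c ^ 4 * (1 / real k ^ 2))"
    by (intro summable_mult) (use inverse_power_summable[of 2] in \<open>simp add: field_simps\<close>)
  then have "summable (\<lambda>k. measure lborel (A k))"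
    by (rule summable_comparison_test'[where N = 1]) (use bound in auto)
  then have "AE x in lborel. \<forall>\<^sub>F k in sequentially. x \<in> space lborel - A k"
    using fin sets_busy by (intro borel_cantelli_AE1) (simp_all add: A_def)
  then show ?thesis
  proof (rule AE_mp, intro AE_I2 impI)
    fix x :: real assume ev: "\<forall>\<^sub>F k in sequentially. x \<in> space lborel - A k" and x: "0 \<le> x" "x < 1"
    have "\<lfloor>x\<rfloor> = 0" using x by (simp add: floor_eq_iff)
    show "\<forall>\<^sub>F k in sequentially. visits x 0 (k\<^sup>2) \<le> k"
      using ev
    proof eventually_elim
      case (elim k)
      then show ?case using \<open>\<lfloor>x\<rfloor> = 0\<close> by (simp add: A_def busy_def not_le less_Suc_eq_le)
    qed
  qed
qed

lemma visits_mono: "n \<le> n' \<Longrightarrow> visits x m n \<le> visits x m n'"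
  unfolding visits_def by (intro card_mono) auto

lemma visits_density_tendsto_0:
  assumes "\<forall>\<^sub>F k in sequentially. visits x 0 (k\<^sup>2) \<le> k"
  shows "(\<lambda>n. real (visits x 0 n) / real n) \<longlonglongrightarrow> 0"
proof -
  obtain K where K: "visits x 0 (k\<^sup>2) \<le> k" if "K \<le> k" for k
    using assms by (auto simp: eventually_sequentially)
  have "real (visits x 0 n) / real n \<le> (sqrt (real n) + 1) / real n" if "K\<^sup>2 \<le> n" for n
  proof (intro divide_right_mono)
    define k where "k = nat \<lceil>sqrt (real n)\<rceil>"
    have k: "sqrt (real n) \<le> real k" "real k \<le> sqrt (real n) + 1"
      using ceiling_correct[of "sqrt (real n)"] by (simp_all add: k_def)
    have "(sqrt (real n))\<^sup>2 \<le> (real k)\<^sup>2" using k(1) by (intro power_mono) simp_all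
    then have "real n \<le> real (k\<^sup>2)" by simp
    then have "n \<le> k\<^sup>2" by (simp only: of_nat_le_iff)
    moreover from this that have "K\<^sup>2 \<le> k\<^sup>2" by (rule order_trans[rotated])
    then have "K \<le> k" by (simp only: power2_nat_le_eq_le)
    ultimately have "visits x 0 n \<le> k" using K[of k] visits_mono[of n "k\<^sup>2" x 0] by linarith
    with k show "real (visits x 0 n) \<le> sqrt (real n) + 1" by linarith
  qed simp
  then have "\<forall>\<^sub>F n in sequentially. norm (real (visits x 0 n) / real n) \<le> (sqrt (real n) + 1) / real n"
    unfolding eventually_sequentially by (intro exI[of _ "K\<^sup>2"]) simp
  moreover have "(\<lambda>n. (sqrt (real n) + 1) / real n) \<longlonglongrightarrow> 0"
  proof -
    have "filterlim (\<lambda>n. sqrt (real n)) at_infinity sequentially"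
      by (intro filterlim_at_top_imp_at_infinity filterlim_compose[OF sqrt_at_top]
          filterlim_real_sequentially)
    then have "(\<lambda>n. 1 / sqrt (real n) + 1 / real n) \<longlonglongrightarrow> 0 + 0"
      by (intro tendsto_add tendsto_divide_0[OF tendsto_const] lim_1_over_n)
    moreover have "(sqrt (real n) + 1) / real n = 1 / sqrt (real n) + 1 / real n" for n
      by (simp add: add_divide_distrib sqrt_divide_self_eq inverse_eq_divide)
    ultimately show ?thesis by simp
  qed
  ultimately show ?thesis by (rule Lim_null_comparison)
qed

text \<open>
  From a point at distance at least \<open>e\<close> to the right of an integer, \<open>M\<close> steps in the left branch would
  exceed $1$, so a visit follows within \<open>M\<close> steps; and each visit is responsible for at most \<open>M\<close> such
  times.
\<close>

lemma card_far_le_visits: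
  assumes M: "1 < lam ^ M * e"
  shows "card {i\<in>{..<n}. e \<le> frac ((F ^^ i) x)} \<le> M * visits x 0 (n + M)"
proof -
  define V where "V = {i \<in> {0<..n + M}. odd \<lfloor>(F ^^ i) x\<rfloor>}"
  have "{i\<in>{..<n}. e \<le> frac ((F ^^ i) x)} \<subseteq> (\<Union>v\<in>V. {i. i < v \<and> v \<le> i + M})"
  proof
    fix i assume "i \<in> {i\<in>{..<n}. e \<le> frac ((F ^^ i) x)}"
    then have i: "i < n" "e \<le> frac ((F ^^ i) x)" by auto
    have "\<exists>v. i < v \<and> v \<le> i + M \<and> odd \<lfloor>(F ^^ v) x\<rfloor>"
    proof (rule ccontr)
      assume "\<not> ?thesis"
      then have "lam ^ M * frac ((F ^^ i) x) \<le> frac ((F ^^ (i + M)) x)"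
        by (intro frac_Fn_ge) auto
      moreover have "lam ^ M * e \<le> lam ^ M * frac ((F ^^ i) x)"
        using i lam by (intro mult_left_mono) auto
      ultimately show False using M frac_lt_1[of "(F ^^ (i + M)) x"] by linarith
    qed
    then obtain v where v: "i < v" "v \<le> i + M" "odd \<lfloor>(F ^^ v) x\<rfloor>" by blast
    then have "v \<in> V" using i(1) by (simp add: V_def)
    with v show "i \<in> (\<Union>v\<in>V. {i. i < v \<and> v \<le> i + M})" by blast
  qed
  then have "card {i\<in>{..<n}. e \<le> frac ((F ^^ i) x)} \<le> card (\<Union>v\<in>V. {i. i < v \<and> v \<le> i + M})"
    by (intro card_mono finite_UN_I) (auto simp: V_def)
  also have "\<dots> \<le> (\<Sum>v\<in>V. card {i. i < v \<and> v \<le> i + M})"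
    by (intro card_UN_le) (simp add: V_def)
  also have "\<dots> \<le> (\<Sum>v\<in>V. M)"
  proof (rule sum_mono)
    fix v
    have "{i. i < v \<and> v \<le> i + M} \<subseteq> {v - M..<v}" by auto
    then have "card {i. i < v \<and> v \<le> i + M} \<le> card {v - M..<v}" by (intro card_mono) auto
    then show "card {i. i < v \<and> v \<le> i + M} \<le> M" by simp
  qed
  finally show ?thesis by (simp add: V_def visits_def mult.commute)
qed

subsection \<open>The induced circle map\<close>

lemma circle_map_F: "circle_map F (circle_of x) = circle_of (F x)"
  by (rule circle_map_circle_of[where d = 2]) (simp add: F_plus_one)

lemma circle_map_F_funpow: "(circle_map F ^^ n) (circle_of x) = circle_of ((F ^^ n) x)"
  by (induction n) (simp_all add: circle_map_F)

lemma emeasure_basin: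
  assumes "0 < c" and "\<And>k. 0 < k \<Longrightarrow> c / sqrt (real k) \<le> trap (k\<^sup>2)"
  shows "emeasure lebesgue_circle (basin (circle_map F) (return borel (circle_of 0))) = 1"
proof (rule emeasure_lebesgue_circle_eq_1)
  have "AE x in lborel. 0 \<le> x \<longrightarrow> x < 1 \<longrightarrow>
      (\<forall>\<^sub>F k in sequentially. visits x 0 (k\<^sup>2) \<le> k)"
    by (rule AE_eventually_visits_le[OF assms(1)]) (rule assms(2))
  then show "AE x in lborel. 0 \<le> x \<longrightarrow> x < 1 \<longrightarrow>
      circle_of x \<in> basin (circle_map F) (return borel (circle_of 0))"
  proof (rule AE_mp, intro AE_I2 impI)
    fix x :: real
    assume ev: "0 \<le> x \<longrightarrow> x < 1 \<longrightarrow> (\<forall>\<^sub>F k in sequentially. visits x 0 (k\<^sup>2) \<le> k)"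
      and x: "0 \<le> x" "x < 1"
    have density: "(\<lambda>n. real (visits x 0 n) / real n) \<longlonglongrightarrow> 0"
      using ev x by (intro visits_density_tendsto_0) simp
    show "circle_of x \<in> basin (circle_map F) (return borel (circle_of 0))"
    proof (rule dirac_basin_circleI)
      fix e :: real assume "0 < e"
      then obtain M where M: "1 < lam ^ M * e" using ex_lam_power_gt by blast
      have "(\<lambda>n. real (visits x 0 (n + M)) / real (n + M)) \<longlonglongrightarrow> 0"
        by (rule LIMSEQ_ignore_initial_segment[OF density])
      moreover have "(\<lambda>n. 1 + real M * (1 / real n)) \<longlonglongrightarrow> 1 + real M * 0"
        by (intro tendsto_intros lim_1_over_n)
      ultimately have "(\<lambda>n. real M * ((real (visits x 0 (n + M)) / real (n + M)) * (1 + real M * (1 / real n))))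
          \<longlonglongrightarrow> real M * (0 * (1 + real M * 0))"
        by (intro tendsto_mult tendsto_const)
      then have lim: "(\<lambda>n. real M * ((real (visits x 0 (n + M)) / real (n + M)) * (1 + real M * (1 / real n)))) \<longlonglongrightarrow> 0"
        by simp
      show "(\<lambda>n. real (card {i \<in> {..<n}. e \<le> circle_frac ((circle_map F ^^ i) (circle_of x))}) / real n)
          \<longlonglongrightarrow> 0"
      proof (rule Lim_null_comparison[OF _ lim], unfold eventually_sequentially, intro exI allI impI)
        fix n :: nat assume n: "1 \<le> n"
        have "real (card {i \<in> {..<n}. e \<le> circle_frac ((circle_map F ^^ i) (circle_of x))})
            \<le> real (M * visits x 0 (n + M))"
          unfolding circle_map_F_funpow circle_frac_circle_of
          using card_far_le_visits[OF M, of n x] by (simp only: of_nat_le_iff)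
        then have "real (card {i \<in> {..<n}. e \<le> circle_frac ((circle_map F ^^ i) (circle_of x))}) / real n
            \<le> real (M * visits x 0 (n + M)) / real n"
          by (rule divide_right_mono) simp
        also have "\<dots> = real M * ((real (visits x 0 (n + M)) / real (n + M)) * (1 + real M * (1 / real n)))"
        proof -
          have "1 + real M * (1 / real n) = real (n + M) / real n"
            using n by (simp add: field_simps)
          then show ?thesis using n by simp
        qed
        finally show "norm (real (card {i \<in> {..<n}. e \<le> circle_frac ((circle_map F ^^ i) (circle_of x))}) / real n)
            \<le> real M * ((real (visits x 0 (n + M)) / real (n + M)) * (1 + real M * (1 / real n)))"
          by simp
      qed
    qed
  qed
qed

lemma circle_map_F_in_doubling_class: "circle_map F \<in> doubling_class"
proof -
  obtain h :: "real \<Rightarrow> real" where h: "strict_mono h" "surj h"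
    and shift: "\<And>x. h (x + 1) = h x + 1" and conj: "\<And>x. h (F x) = 2 * h x"
    using conjugating_lift by blast
  have h_circle: "circle_map h (circle_of x) = circle_of (h x)" for x
    by (rule circle_map_circle_of[where d = 1]) (simp add: shift)
  have "circle_map h \<circ> circle_map F = doubling \<circ> circle_map h"
  proof
    fix c
    obtain x where "c = circle_of x" using surj_circle_of by (auto simp: surj_def)
    then show "(circle_map h \<circ> circle_map F) c = (doubling \<circ> circle_map h) c"
      by (simp add: circle_map_F h_circle conj doubling_circle_of)
  qed
  then have "topologically_conjugate (circle_map F) doubling"
    unfolding topologically_conjugate_def using homeomorphism_circle_map[OF shift h] by blast
  moreover have "local_homeomorphism (circle_map F)"
    by (rule local_homeomorphism_circle_map[where d = 2]) (simp_all add: F_plus_one mono_F surj_F)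
  ultimately show ?thesis by (simp add: doubling_class_def)
qed

text \<open>
  The conjugacy transports the statement to the doubling map, where it is $2y = y + m$.
\<close>

lemma fixed_points: "{x. circle_map F x = x} = {circle_of 0}"
proof -
  obtain h :: "real \<Rightarrow> real" where h: "strict_mono h" "surj h"
    and shift: "\<And>x. h (x + 1) = h x + 1" and conj: "\<And>x. h (F x) = 2 * h x"
    using conjugating_lift by blast
  have h_int: "h (x + of_int m) = h x + of_int m" for x m
    using lift_add_int[of h 1 x m] shift by simp
  have "h 0 = 0" using conj[of 0] by simp
  have "c = circle_of 0" if fixed: "circle_map F c = c" for c
  proof -
    obtain x where x: "c = circle_of x" using surj_circle_of by (auto simp: surj_def)
    with fixed have "F x - x \<in> \<int>" by (simp add: circle_map_F circle_of_eq_iff)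
    then obtain m where "F x = x + of_int m" by (metis Ints_cases diff_add_cancel add.commute)
    then have "h x = of_int m" using conj[of x] h_int[of x m] by simp
    also have "\<dots> = h (of_int m)" using h_int[of 0 m] \<open>h 0 = 0\<close> by simp
    finally have "x = of_int m" using h(1) by (simp only: strict_mono_eq)
    then show ?thesis by (simp add: x circle_of_eq_iff)
  qed
  then show ?thesis by (auto simp: circle_map_F)
qed

lemma preimages_of_fixed_point: "circle_map F -` {circle_of 0} = {circle_of 0, circle_of q}"
proof -
  have "c \<in> {circle_of 0, circle_of q}" if c: "circle_map F c = circle_of 0" for c
  proof -
    obtain x where x: "c = circle_of x" using surj_circle_of by (auto simp: surj_def)
    with c have "F x \<in> \<int>" by (simp add: circle_map_F circle_of_eq_iff)
    then obtain m where "F x = of_int m" by (elim Ints_cases)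
    then have m: "x = G (of_int m)" by (metis G_F)
    show ?thesis
    proof (cases "even m")
      case True
      then obtain k where "m = 2 * k" by (elim evenE)
      with m have "x = of_int k" by (simp add: G_double)
      then show ?thesis by (simp add: x circle_of_eq_iff)
    next
      case False
      then obtain k where "m = 2 * k + 1" by (elim oddE)
      with m have "x = of_int k + q" by (simp add: G_double)
      then show ?thesis by (simp add: x circle_of_eq_iff)
    qed
  qed
  moreover have "circle_of 1 = circle_of 0" by (simp add: circle_of_eq_iff)
  ultimately show ?thesis by (auto simp: circle_map_F)
qed

end

section \<open>A convex branch with a flat point\<close>

text \<open>
  The value at $1$ is $1$, and the constant $2$ is large enough for convexity on all of
  $[0,1]$. The exponent $4$ makes the traps for $N = k^2$ as wide as a multiple of $k^{-1/2}$.
\<close>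

definition flat_branch :: "real \<Rightarrow> real"
  where "flat_branch t = (if t \<le> 0 then 0 else exp (2 - 2 / t ^ 4))"

definition flat_branch_inv :: "real \<Rightarrow> real"
  where "flat_branch_inv u = (if u \<le> 0 then 0 else 1 / root 4 (1 - ln u / 2))"

lemma flat_branch_nonneg: "0 \<le> flat_branch t"
  by (simp add: flat_branch_def)

lemma flat_branch_0 [simp]: "flat_branch 0 = 0" and flat_branch_1 [simp]: "flat_branch 1 = 1"
  by (simp_all add: flat_branch_def)

lemma flat_branch_strict_mono:
  assumes "0 \<le> s" "s < t"
  shows "flat_branch s < flat_branch t"
proof (cases "s = 0")
  case False
  then have "s ^ 4 < t ^ 4" "0 < s ^ 4" "0 < t ^ 4"
    using assms by (auto intro: power_strict_mono)
  then have "2 / t ^ 4 < 2 / s ^ 4" by (intro divide_strict_left_mono mult_pos_pos) auto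
  then show ?thesis using assms False by (simp add: flat_branch_def)
qed (use assms in \<open>simp add: flat_branch_def\<close>)

lemma flat_branch_lt_1: "t < 1 \<Longrightarrow> flat_branch t < 1"
  using flat_branch_strict_mono[of t 1] by (cases "0 \<le> t") (auto simp: flat_branch_def)

lemma flat_branch_inv_flat_branch:
  assumes "0 \<le> t"
  shows "flat_branch_inv (flat_branch t) = t"
proof (cases "t = 0")
  case True
  then show ?thesis by (simp add: flat_branch_inv_def)
next
  case False
  then have t: "0 < t" using assms by simp
  have "1 - ln (flat_branch t) / 2 = (1 / t) ^ 4" using t by (simp add: flat_branch_def power_one_over diff_divide_distrib)
  moreover have "root 4 ((1 / t) ^ 4) = 1 / t" using t by (intro real_root_power_cancel) auto
  ultimately show ?thesis using t by (simp add: flat_branch_inv_def) (simp add: flat_branch_def)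
qed

lemma flat_branch_inv_pos:
  assumes "0 < u" "u \<le> 1"
  shows "0 < flat_branch_inv u"
proof -
  have "ln u \<le> 0" using ln_le_zero_iff[of u] assms by simp
  then have "0 < 1 - ln u / 2" by simp
  then show ?thesis using assms by (simp add: flat_branch_inv_def)
qed

lemma flat_branch_flat_branch_inv:
  assumes "0 \<le> u" "u \<le> 1"
  shows "flat_branch (flat_branch_inv u) = u"
proof (cases "u = 0")
  case True
  then show ?thesis by (simp add: flat_branch_inv_def)
next
  case False
  then have u: "0 < u" using assms by simp
  have "ln u \<le> 0" using ln_le_zero_iff[of u] u assms by simp
  then have "0 < 1 - ln u / 2" by simp
  then have "flat_branch_inv u ^ 4 = 1 / (1 - ln u / 2)"
    using u by (simp add: flat_branch_inv_def power_one_over)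
  then have "2 / flat_branch_inv u ^ 4 = 2 - ln u" by simp
  then show ?thesis using flat_branch_inv_pos[of u] u assms by (simp add: flat_branch_def)
qed

lemma flat_branch_inv_bounds:
  assumes "0 \<le> u" "u \<le> 1"
  shows "0 \<le> flat_branch_inv u" "flat_branch_inv u \<le> 1" "u < 1 \<Longrightarrow> flat_branch_inv u < 1"
proof -
  show nonneg: "0 \<le> flat_branch_inv u"
    using flat_branch_inv_pos[of u] assms by (cases "u = 0") (auto simp: flat_branch_inv_def)
  have *: "1 < flat_branch_inv u \<Longrightarrow> 1 < u"
    using flat_branch_strict_mono[of 1 "flat_branch_inv u"] flat_branch_flat_branch_inv assms by simp
  then show "flat_branch_inv u \<le> 1" using assms by linarith
  show "flat_branch_inv u < 1" if "u < 1"
  proof -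
    have "flat_branch_inv u \<noteq> 1" using flat_branch_flat_branch_inv[OF assms] that by (metis flat_branch_1 less_irrefl)
    then show ?thesis using * assms by linarith
  qed
qed

text \<open>
  The formula without the case distinction at $0$, which is the one to differentiate.
\<close>

definition flat_exp :: "real \<Rightarrow> real"
  where "flat_exp t = exp (2 - 2 / t ^ 4)"

lemma flat_branch_eq: "0 < t \<Longrightarrow> flat_branch t = flat_exp t"
  by (simp add: flat_branch_def flat_exp_def)

lemma DERIV_flat_exp:
  assumes "0 < t"
  shows "(flat_exp has_real_derivative 8 / t ^ 5 * flat_exp t) (at t)"
  unfolding flat_exp_def using assms
  by (auto intro!: derivative_eq_intros simp: field_simps power_numeral_reduce)

text \<open>
  Functions of this form are closed under differentiation, which gives both the second derivative
  needed for convexity and all higher derivatives.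
\<close>

lemma DERIV_poly_flat_exp:
  assumes "0 < t"
  shows "((\<lambda>t. poly P (1 / t) * flat_exp t) has_real_derivative
    poly ([:0, 0, 0, 0, 0, 8:] * P - [:0, 0, 1:] * pderiv P) (1 / t) * flat_exp t) (at t)"
proof -
  have "((\<lambda>t. 1 / t) has_real_derivative - (1 / t ^ 2)) (at t)"
    using assms by (auto intro!: derivative_eq_intros simp: power2_eq_square)
  from DERIV_chain2[OF poly_DERIV this, of P]
  have "((\<lambda>t. poly P (1 / t)) has_real_derivative poly (pderiv P) (1 / t) * - (1 / t ^ 2)) (at t)" .
  from DERIV_mult[OF this DERIV_flat_exp[OF assms]]
  show ?thesis
    by (rule DERIV_cong) (use assms in \<open>simp add: field_simps power_numeral_reduce\<close>)
qed

text \<open>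
  On $(0,1]$ the second derivative is $8 w^6 (8 w^4 - 5)$ times the function with $w = 1/t \ge 1$,
  hence positive. The end point $0$ is added by the inequality $\Phi(v y) \le v \Phi(y)$.
\<close>

lemma convex_flat_branch: "convex_on {0..1} flat_branch"
proof -
  have E: "convex_on {0<..1} flat_exp"
  proof (rule f''_ge0_imp_convex)
    fix t :: real assume t: "t \<in> {0<..1}"
    show "(flat_exp has_real_derivative poly [:0, 0, 0, 0, 0, 8:] (1 / t) * flat_exp t) (at t)"
      using DERIV_poly_flat_exp[of t 1] t by simp
    let ?P = "[:0, 0, 0, 0, 0, 8:] * [:0, 0, 0, 0, 0, 8:] - [:0, 0, 1:] * pderiv [:0, 0, 0, 0, 0, 8::real:]"
    show "((\<lambda>t. poly [:0, 0, 0, 0, 0, 8:] (1 / t) * flat_exp t) has_real_derivative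
        poly ?P (1 / t) * flat_exp t) (at t)"
      using DERIV_poly_flat_exp[of t "[:0, 0, 0, 0, 0, 8:]"] t by simp
    define w where "w = 1 / t"
    have w: "1 \<le> w" using t by (simp add: w_def)
    have "poly ?P w = 8 * w ^ 6 * (8 * w ^ 4 - 5)"
      by (simp add: pderiv_pCons algebra_simps power_numeral_reduce)
    moreover have "1 \<le> w ^ 4" using w by (rule one_le_power)
    then have "0 \<le> 8 * w ^ 4 - 5" by linarith
    then have "0 \<le> 8 * w ^ 6 * (8 * w ^ 4 - 5)" using w by (intro mult_nonneg_nonneg) auto
    ultimately have "0 \<le> poly ?P w" by (simp only:)
    then have "0 \<le> poly ?P (1 / t)" unfolding w_def .
    then show "0 \<le> poly ?P (1 / t) * flat_exp t"
      by (rule mult_nonneg_nonneg) (simp add: flat_exp_def)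
  qed simp
  have at_0: "flat_branch (v * y) \<le> v * flat_branch y" if v: "0 \<le> v" "v \<le> 1" and y: "0 \<le> y" "y \<le> 1" for v y
  proof (cases "v = 0 \<or> y = 0")
    case False
    then have gt_0: "0 < v" "0 < y" using v y by auto
    have "ln (1 / v) \<le> 1 / v - 1" using gt_0 by (intro ln_le_minus_one) simp
    also have "\<dots> \<le> 1 / v ^ 4 - 1"
    proof -
      have "v ^ 4 \<le> v" using power_decreasing[of 1 4 v] v by simp
      then show ?thesis using gt_0 by (simp add: frac_le)
    qed
    also have "\<dots> \<le> 2 / y ^ 4 * (1 / v ^ 4 - 1)"
    proof -
      have "y ^ 4 \<le> 1" using y by (simp add: power_le_one)
      then have "1 \<le> 2 / y ^ 4" using gt_0 by (simp add: field_simps)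
      moreover have "0 \<le> 1 / v ^ 4 - 1" using v gt_0 by (simp add: power_le_one)
      ultimately show ?thesis 
        using mult_right_mono[of 1 "2 / y ^ 4" "1 / v ^ 4 - 1"] by (simp only: mult_1)
    qed
    also have "\<dots> = 2 / (v * y) ^ 4 - 2 / y ^ 4"
      by (simp add: power_mult_distrib right_diff_distrib diff_divide_distrib mult.commute)
    finally have "2 - 2 / (v * y) ^ 4 \<le> ln v + (2 - 2 / y ^ 4)"
      using gt_0 by (simp add: ln_div)
    then have "exp (2 - 2 / (v * y) ^ 4) \<le> exp (ln v + (2 - 2 / y ^ 4))" by simp
    then show ?thesis using gt_0 by (simp add: flat_branch_def exp_add)
  qed auto
  show ?thesis
    unfolding convex_on_def
  proof (intro conjI ballI allI impI)
    fix x y u v :: real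
    assume x: "x \<in> {0..1}" and y: "y \<in> {0..1}" and uv: "0 \<le> u" "0 \<le> v" "u + v = 1"
    consider "x = 0" | "y = 0" | "0 < x" "0 < y" using x y by fastforce
    then show "flat_branch (u *\<^sub>R x + v *\<^sub>R y) \<le> u * flat_branch x + v * flat_branch y"
    proof cases
      case 1
      then show ?thesis using at_0[of v y] uv y by simp
    next
      case 2
      then show ?thesis using at_0[of u x] uv x by simp
    next
      case 3
      have "u *\<^sub>R x + v *\<^sub>R y \<in> {0<..1}"
        using 3 x y uv by (intro convexD[of "{0<..1::real}"]) auto
      moreover have "flat_exp (u *\<^sub>R x + v *\<^sub>R y) \<le> u * flat_exp x + v * flat_exp y"
        using E 3 x y uv unfolding convex_on_def by auto
      ultimately show ?thesis using 3 by (simp add: flat_branch_eq)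
    qed
  qed simp
qed

lemma concave_flat_branch_inv: "concave_on {0..1} flat_branch_inv"
  unfolding concave_on_iff
proof (intro conjI ballI allI impI)
  fix x y u v :: real
  assume x: "x \<in> {0..1}" and y: "y \<in> {0..1}" and uv: "0 \<le> u" "0 \<le> v" "u + v = 1"
  define w where "w = u *\<^sub>R x + v *\<^sub>R y"
  have w: "w \<in> {0..1}"
    unfolding w_def using x y uv by (intro convexD[of "{0..1::real}"]) auto
  have "flat_branch (u *\<^sub>R flat_branch_inv x + v *\<^sub>R flat_branch_inv y) \<le> u * flat_branch (flat_branch_inv x) + v * flat_branch (flat_branch_inv y)"
    using convex_flat_branch flat_branch_inv_bounds[of x] flat_branch_inv_bounds[of y] x y uv
    unfolding convex_on_def by auto
  also have "\<dots> = flat_branch (flat_branch_inv w)"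
    using x y w by (simp add: flat_branch_flat_branch_inv w_def)
  finally have less: "\<not> flat_branch (flat_branch_inv w) < flat_branch (u *\<^sub>R flat_branch_inv x + v *\<^sub>R flat_branch_inv y)" by simp
  have "\<not> flat_branch_inv w < u *\<^sub>R flat_branch_inv x + v *\<^sub>R flat_branch_inv y"
    using less flat_branch_strict_mono flat_branch_inv_bounds(1)[of w] w by auto
  then show "u * flat_branch_inv x + v * flat_branch_inv y \<le> flat_branch_inv (u *\<^sub>R x + v *\<^sub>R y)"
    by (simp add: w_def)
qed simp

text \<open>
  The extension of a self-map of $[0,1)$ that commutes with integer translations.
\<close>

definition unroll :: "(real \<Rightarrow> real) \<Rightarrow> real \<Rightarrow> real"
  where "unroll g t = of_int \<lfloor>t\<rfloor> + g (frac t)"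

lemma unroll_add_int: "unroll g (t + of_int m) = unroll g t + of_int m"
  by (simp add: unroll_def frac_def)

lemma unroll_eq: "0 \<le> t \<Longrightarrow> t < 1 \<Longrightarrow> unroll g t = g t"
  by (simp add: unroll_def frac_eq floor_eq_iff)

lemma unroll_unroll:
  assumes "\<And>t. 0 \<le> t \<Longrightarrow> t < 1 \<Longrightarrow> 0 \<le> g t \<and> g t < 1 \<and> k (g t) = t"
  shows "unroll k (unroll g t) = t"
proof -
  have g: "0 \<le> g (frac t)" "g (frac t) < 1" "k (g (frac t)) = frac t"
    using assms[of "frac t"] by (simp_all add: frac_lt_1)
  have "unroll k (unroll g t) = unroll k (g (frac t)) + of_int \<lfloor>t\<rfloor>"
    unfolding unroll_def[of g] by (simp only: add.commute[of "of_int \<lfloor>t\<rfloor>"] unroll_add_int)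
  then show ?thesis using g by (simp add: unroll_eq frac_def)
qed

lemma strict_mono_unroll:
  assumes "\<And>s t. 0 \<le> s \<Longrightarrow> s < t \<Longrightarrow> t < 1 \<Longrightarrow> g s < g t"
    and "\<And>t. 0 \<le> t \<Longrightarrow> t < 1 \<Longrightarrow> 0 \<le> g t \<and> g t < 1"
  shows "strict_mono (unroll g)"
proof (rule strict_monoI)
  fix s t :: real assume "s < t"
  have g: "0 \<le> g (frac t)" "g (frac s) < 1"
    using assms(2) by (simp_all add: frac_lt_1)
  show "unroll g s < unroll g t"
  proof (cases "\<lfloor>s\<rfloor> = \<lfloor>t\<rfloor>")
    case True
    then have "frac s < frac t" using \<open>s < t\<close> by (simp add: frac_def)
    then show ?thesis using True assms(1)[of "frac s" "frac t"] by (simp add: unroll_def frac_lt_1)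
  next
    case False
    then have "\<lfloor>s\<rfloor> + 1 \<le> \<lfloor>t\<rfloor>" using floor_mono[of s t] \<open>s < t\<close> by linarith
    then have "real_of_int \<lfloor>s\<rfloor> + 1 \<le> of_int \<lfloor>t\<rfloor>" by linarith
    then show ?thesis using g by (simp add: unroll_def)
  qed
qed

section \<open>The map and its smoothness\<close>

text \<open>
  The position of the fixed point when the flat point is placed at $0$; translating by it moves the
  fixed point to $0$ and the flat point to $1 -$ \<open>half_point\<close>.
\<close>

definition half_point :: real where "half_point = flat_branch_inv (1 / 2)"

definition sisyphus_lift :: "real \<Rightarrow> real" where "sisyphus_lift x = 2 * unroll flat_branch (x + half_point) - 1"

definition sisyphus_lift_inv :: "real \<Rightarrow> real" where "sisyphus_lift_inv y = unroll flat_branch_inv ((y + 1) / 2) - half_point"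

lemma half_point: "0 < half_point" "half_point < 1" "flat_branch half_point = 1 / 2"
  using flat_branch_inv_pos[of "1/2"] flat_branch_inv_bounds(3)[of "1/2"] flat_branch_flat_branch_inv[of "1/2"]
  by (simp_all add: half_point_def)

lemma sisyphus_lift_eq: "- half_point \<le> x \<Longrightarrow> x \<le> 1 - half_point \<Longrightarrow> sisyphus_lift x = 2 * flat_branch (x + half_point) - 1"
  by (cases "x = 1 - half_point") (simp_all add: sisyphus_lift_def unroll_eq, simp add: unroll_def)

lemma sisyphus_lift_inv_eq_left: "0 \<le> y \<Longrightarrow> y \<le> 1 \<Longrightarrow> sisyphus_lift_inv y = flat_branch_inv ((y + 1) / 2) - half_point"
  using flat_branch_inv_flat_branch[of 1] by (cases "y = 1") (auto simp: sisyphus_lift_inv_def unroll_eq, simp add: unroll_def flat_branch_inv_def)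

lemma sisyphus_lift_inv_eq_right:
  assumes "1 \<le> y" "y \<le> 2"
  shows "sisyphus_lift_inv y = flat_branch_inv ((y - 1) / 2) + (1 - half_point)"
proof -
  have "(y + 1) / 2 = (y - 1) / 2 + of_int 1" by (simp add: field_simps)
  then have "unroll flat_branch_inv ((y + 1) / 2) = unroll flat_branch_inv ((y - 1) / 2) + of_int 1"
    by (simp only: unroll_add_int)
  then show ?thesis using assms by (simp add: sisyphus_lift_inv_def unroll_eq)
qed

lemma concave_on_affine:
  fixes g :: "real \<Rightarrow> real"
  assumes "concave_on {0..1} g" and "\<And>y. y \<in> S \<Longrightarrow> f y = g ((y + a) / 2) + b"
    and "\<And>y. y \<in> S \<Longrightarrow> (y + a) / 2 \<in> {0..1}" and "convex S"
  shows "concave_on S f"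
  unfolding concave_on_iff
proof (intro conjI ballI allI impI assms(4))
  fix x y u v :: real
  assume xy: "x \<in> S" "y \<in> S" and uv: "0 \<le> u" "0 \<le> v" "u + v = 1"
  have u: "u = 1 - v" using uv by simp
  have S: "u *\<^sub>R x + v *\<^sub>R y \<in> S" using assms(4) xy uv by (rule convexD)
  have "u * g ((x + a) / 2) + v * g ((y + a) / 2) \<le> g (u *\<^sub>R ((x + a) / 2) + v *\<^sub>R ((y + a) / 2))"
    using assms(1) assms(3)[OF xy(1)] assms(3)[OF xy(2)] uv unfolding concave_on_iff by blast
  also have "u *\<^sub>R ((x + a) / 2) + v *\<^sub>R ((y + a) / 2) = (u *\<^sub>R x + v *\<^sub>R y + a) / 2"
    by (simp add: u field_simps)
  finally have "u * g ((x + a) / 2) + v * g ((y + a) / 2) + (u + v) * b \<le> f (u *\<^sub>R x + v *\<^sub>R y)"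
    using assms(2)[OF S] uv(3) by simp
  then show "u * f x + v * f y \<le> f (u *\<^sub>R x + v *\<^sub>R y)"
    by (simp add: assms(2) xy algebra_simps)
qed

interpretation sisyphus: convex_doubling_lift sisyphus_lift sisyphus_lift_inv "1 - half_point" "1 / half_point"
proof
  have flat_unit: "0 \<le> flat_branch t \<and> flat_branch t < 1 \<and> flat_branch_inv (flat_branch t) = t" if "0 \<le> t" "t < 1" for t
    using that by (simp add: flat_branch_nonneg flat_branch_lt_1 flat_branch_inv_flat_branch)
  have flat_branch_inv_unit: "0 \<le> flat_branch_inv u \<and> flat_branch_inv u < 1 \<and> flat_branch (flat_branch_inv u) = u"
    if "0 \<le> u" "u < 1" for u
    using that by (simp add: flat_branch_inv_bounds flat_branch_flat_branch_inv)
  show "sisyphus_lift (sisyphus_lift_inv y) = y" for y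
  proof -
    have "unroll flat_branch (unroll flat_branch_inv ((y + 1) / 2)) = (y + 1) / 2"
      by (rule unroll_unroll[OF flat_branch_inv_unit])
    then show ?thesis by (simp add: sisyphus_lift_def sisyphus_lift_inv_def)
  qed
  show "sisyphus_lift_inv (sisyphus_lift x) = x" for x
    by (simp add: sisyphus_lift_def sisyphus_lift_inv_def unroll_unroll[OF flat_unit])
  have "strict_mono (unroll flat_branch)"
    using flat_unit by (intro strict_mono_unroll flat_branch_strict_mono) auto
  then show "strict_mono sisyphus_lift" by (simp add: strict_mono_def sisyphus_lift_def)
  show "sisyphus_lift (x + 1) = sisyphus_lift x + 2" for x
    using unroll_add_int[of flat_branch "x + half_point" 1] by (simp add: sisyphus_lift_def add_ac)
  show "sisyphus_lift 0 = 0" using half_point by (simp add: sisyphus_lift_eq)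
  show "sisyphus_lift (1 - half_point) = 1" by (simp add: sisyphus_lift_def unroll_def)
  show "0 < 1 - half_point" "1 - half_point < 1" "1 < 1 / half_point" using half_point by simp_all
  show "concave_on {0..1} sisyphus_lift_inv"
    by (rule concave_on_affine[OF concave_flat_branch_inv, of _ _ 1 "- half_point"]) (auto simp: sisyphus_lift_inv_eq_left)
  show "concave_on {1..2} sisyphus_lift_inv"
    by (rule concave_on_affine[OF concave_flat_branch_inv, of _ _ "- 1" "1 - half_point"]) (auto simp: sisyphus_lift_inv_eq_right)
  show "1 / half_point * x \<le> sisyphus_lift x" if x: "0 \<le> x" "x \<le> 1 - half_point" for x
  proof -
    \<comment> \<open>convexity between \<open>0\<close>, \<open>half_point\<close> and \<open>x + half_point\<close>, whose values are \<open>0\<close>, \<open>1 / 2\<close> and \<open>(sisyphus_lift x + 1) / 2\<close>\<close>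
    define v where "v = half_point / (x + half_point)"
    have v: "0 \<le> v" "v \<le> 1" "v * (x + half_point) = half_point" using half_point x by (auto simp: v_def)
    have "flat_branch ((1 - v) *\<^sub>R 0 + v *\<^sub>R (x + half_point)) \<le> (1 - v) * flat_branch 0 + v * flat_branch (x + half_point)"
      by (rule convex_onD[OF convex_flat_branch]) (use v x half_point in auto)
    then have "1 / 2 \<le> v * flat_branch (x + half_point)" using v half_point by simp
    then have "(x + half_point) / half_point \<le> 2 * flat_branch (x + half_point)"
      using half_point x by (simp add: v_def field_simps)
    then show ?thesis using x half_point by (simp add: sisyphus_lift_eq field_simps)
  qed
qed

lemma trap_eq: "sisyphus.trap N = flat_branch_inv ((1 - half_point) ^ N / 2)"
proof -
  have "0 \<le> (1 - half_point) ^ N" "(1 - half_point) ^ N \<le> 1"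
    using half_point by (simp_all add: power_le_one)
  then show ?thesis by (simp add: sisyphus.trap_def sisyphus_lift_inv_eq_right)
qed

text \<open>
  The inverse of the flat branch is $u \mapsto (1 - \frac12 \ln u)^{-1/4}$, and $u = q^N / 2$ with $N = k^2$
  makes the bracket at most a multiple $A$ of $k^2$.
\<close>

lemma trap_lower_bound: "\<exists>c>0. \<forall>k>0. c / sqrt (real k) \<le> sisyphus.trap (k\<^sup>2)"
proof -
  define q where "q = 1 - half_point"
  have q: "0 < q" "q < 1" using half_point by (simp_all add: q_def)
  define A where "A = 1 + (ln 2 - ln q) / 2"
  have ln_q: "ln q < 0" using q by simp
  have ln_2: "0 < ln (2::real)" by simp
  have A: "0 < A"
    unfolding A_def using less_trans[OF ln_q ln_2] by (intro add_pos_pos divide_pos_pos) simp_all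
  have "1 / root 4 A / sqrt (real k) \<le> sisyphus.trap (k\<^sup>2)" if "0 < k" for k
  proof -
    define B where "B = 1 - ln (q ^ k\<^sup>2 / 2) / 2"
    have k2: "1 \<le> real (k\<^sup>2)" using that by (simp add: Suc_le_eq)
    have B_eq: "B = 1 + (ln 2 - real (k\<^sup>2) * ln q) / 2"
      using q by (simp add: B_def ln_div ln_realpow diff_divide_distrib)
    have "0 < B"
    proof -
      have "real (k\<^sup>2) * ln q \<le> 0" using ln_q by (intro mult_nonneg_nonpos) auto
      from le_less_trans[OF this ln_2] show ?thesis
        unfolding B_eq by (intro add_pos_pos divide_pos_pos) simp_all
    qed
    have "B \<le> A * real (k\<^sup>2)"
    proof -
      have "0 \<le> 1 + ln (2::real) / 2" using ln_2 by simp
      then have "(1 + ln 2 / 2) * 1 \<le> (1 + ln 2 / 2) * real (k\<^sup>2)" by (rule mult_left_mono[OF k2])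
      then show ?thesis unfolding B_eq A_def by (simp add: field_simps)
    qed
    then have "root 4 B \<le> root 4 (A * real (k\<^sup>2))" by simp
    also have "\<dots> = root 4 A * root 4 (sqrt (real k) ^ 4)"
    proof -
      have "sqrt (real k) ^ 4 = (sqrt (real k) ^ 2) ^ 2" unfolding power_mult[symmetric] by simp
      then show ?thesis by (simp add: real_root_mult)
    qed
    also have "root 4 (sqrt (real k) ^ 4) = sqrt (real k)" by (intro real_root_power_cancel) auto
    finally have "1 / (root 4 A * sqrt (real k)) \<le> 1 / root 4 B"
      using \<open>0 < B\<close> A that by (intro divide_left_mono) auto
    also have "1 / root 4 B = sisyphus.trap (k\<^sup>2)"
    proof -
      have "0 < q ^ k\<^sup>2 / 2" using zero_less_power[OF q(1)] by (rule half_gt_zero)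
      then have "flat_branch_inv (q ^ k\<^sup>2 / 2) = 1 / root 4 B"
        unfolding flat_branch_inv_def B_def by (intro if_not_P) linarith
      then show ?thesis by (simp add: trap_eq q_def)
    qed
    finally show ?thesis by simp
  qed
  moreover have "0 < 1 / root 4 A" using A by simp
  ultimately show ?thesis by blast
qed

text \<open>
  Analytic on the whole ray to the right of \<open>- half_point\<close>, and equal to the lift on one period
  between consecutive copies of the flat point. This period covers the circle minus that point.
\<close>

definition local_lift :: "real \<Rightarrow> real"
  where "local_lift s = 2 * flat_exp (s + half_point) - 1"

lemma circle_of_local_lift:
  assumes "s \<in> {- half_point<..<1 - half_point}"
  shows "circle_of (local_lift s) = circle_map sisyphus_lift (circle_of s)"
  using assms by (simp add: local_lift_def sisyphus.circle_map_F sisyphus_lift_eq flat_branch_eq)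

lemma higher_deriv_local_lift:
  "\<exists>P b. \<forall>s > - half_point. (deriv ^^ k) local_lift s =
    poly P (1 / (s + half_point)) * flat_exp (s + half_point) + b"
proof (induction k)
  case 0
  show ?case by (intro exI[of _ "[:2:]"] exI[of _ "- 1"]) (simp add: local_lift_def)
next
  case (Suc k)
  then obtain P b where eq: "\<And>s. - half_point < s \<Longrightarrow> (deriv ^^ k) local_lift s =
    poly P (1 / (s + half_point)) * flat_exp (s + half_point) + b" by blast
  define Q where "Q = [:0, 0, 0, 0, 0, 8:] * P - [:0, 0, 1:] * pderiv P"
  have "deriv ((deriv ^^ k) local_lift) s = poly Q (1 / (s + half_point)) * flat_exp (s + half_point)"
    if s: "- half_point < s" for s
  proof (rule DERIV_imp_deriv)
    have "((\<lambda>s. poly P (1 / (s + half_point)) * flat_exp (s + half_point)) has_real_derivative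
        poly Q (1 / (s + half_point)) * flat_exp (s + half_point)) (at s)"
      using DERIV_poly_flat_exp[of "s + half_point" P] s unfolding Q_def by (simp add: DERIV_shift)
    then have "((\<lambda>s. poly P (1 / (s + half_point)) * flat_exp (s + half_point) + b) has_real_derivative
        poly Q (1 / (s + half_point)) * flat_exp (s + half_point)) (at s)"
      using DERIV_add[OF _ DERIV_const] by fastforce
    then show "((deriv ^^ k) local_lift has_real_derivative
        poly Q (1 / (s + half_point)) * flat_exp (s + half_point)) (at s)"
      by (rule has_field_derivative_transform_within_open[of _ _ _ "{- half_point<..}"])
        (use s eq in auto)
  qed
  then show ?case by (intro exI[of _ Q] exI[of _ 0]) simp
qed

lemma field_differentiable_higher_deriv_local_lift:
  assumes "- half_point < s"
  shows "(deriv ^^ k) local_lift field_differentiable at s"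
proof -
  obtain P b where eq: "\<And>s. - half_point < s \<Longrightarrow> (deriv ^^ k) local_lift s =
    poly P (1 / (s + half_point)) * flat_exp (s + half_point) + b"
    using higher_deriv_local_lift by blast
  have "(\<lambda>s. poly P (1 / (s + half_point)) * flat_exp (s + half_point)) field_differentiable at s"
    using DERIV_poly_flat_exp[of "s + half_point" P] assms
    unfolding field_differentiable_def by (auto simp: DERIV_shift)
  then have "(\<lambda>s. poly P (1 / (s + half_point)) * flat_exp (s + half_point) + b) field_differentiable at s"
    by (intro field_differentiable_add field_differentiable_const)
  then show ?thesis
    unfolding field_differentiable_def
    by (elim exE) (rule exI, erule has_field_derivative_transform_within_open[of _ _ _ "{- half_point<..}"],
      use assms eq in auto)
qed

lemma smooth_sisyphus:
  "smooth_circle_map_on (circle_map sisyphus_lift) (- {circle_of (1 - half_point)})"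
  unfolding smooth_circle_map_on_def
proof
  fix x assume x: "x \<in> - {circle_of (1 - half_point)}"
  define r where "r = circle_frac x"
  define t where "t = (if r < 1 - half_point then r else r - 1)"
  have "circle_of (r - 1) = circle_of r" by (simp add: circle_of_eq_iff)
  then have t: "circle_of t = x" by (simp add: t_def r_def)
  have "r \<noteq> 1 - half_point" using x by (metis ComplD circle_of_circle_frac r_def singletonI)
  then have "t \<in> {- half_point<..<1 - half_point}"
    using circle_frac_bounds[of x] half_point by (auto simp: t_def r_def)
  with t show "\<exists>t F V. circle_of t = x \<and> open V \<and> t \<in> V \<and>
      (\<forall>s\<in>V. circle_of (F s) = circle_map sisyphus_lift (circle_of s)) \<and>
      (\<forall>k. \<forall>s\<in>V. ((deriv ^^ k) (F :: real \<Rightarrow> real)) field_differentiable (at s))"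
    by (intro exI[of _ t] exI[of _ local_lift] exI[of _ "{- half_point<..<1 - half_point}"])
      (auto simp: circle_of_local_lift field_differentiable_higher_deriv_local_lift)
qed

lemma sisyphus_derivative:
  "has_circle_derivative (circle_map sisyphus_lift) (8 / half_point ^ 5) (circle_of 0)"
  unfolding has_circle_derivative_def
proof (intro exI conjI)
  show "circle_of 0 = circle_of 0" ..
  have "\<forall>\<^sub>F s in nhds 0. s \<in> {- half_point<..<1 - half_point}"
    using half_point by (intro eventually_nhds_in_open) auto
  then show "\<forall>\<^sub>F s in nhds 0. circle_of (local_lift s) = circle_map sisyphus_lift (circle_of s)"
    by eventually_elim (rule circle_of_local_lift)
  have half: "flat_exp half_point = 1 / 2" using half_point flat_branch_eq[of half_point] by (simp only:)
  then have "(flat_exp has_real_derivative 4 / half_point ^ 5) (at (0 + half_point))"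
    using DERIV_flat_exp[OF half_point(1)] unfolding \<open>flat_exp half_point = 1 / 2\<close> by simp
  then have "((\<lambda>s. flat_exp (s + half_point)) has_real_derivative 4 / half_point ^ 5) (at 0)"
    by (simp only: DERIV_shift)
  then show "(local_lift has_real_derivative 8 / half_point ^ 5) (at 0)"
    unfolding local_lift_def by (auto intro!: derivative_eq_intros)
qed

theorem theorem1p4:
  shows "\<exists>f p q. f \<in> doubling_class \<and>
    {x. f x = x} = {p} \<and> f -` {p} = {p, q} \<and> q \<noteq> p \<and>
    smooth_circle_map_on f (- {q}) \<and>
    sisyphus_attractor f p \<and>
    emeasure lebesgue_circle (basin f (return borel p)) = 1"
proof (intro exI conjI)
  let ?f = "circle_map sisyphus_lift" and ?p = "circle_of 0" and ?q = "circle_of (1 - half_point)"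
  obtain c where "0 < c" "\<And>k. 0 < k \<Longrightarrow> c / sqrt (real k) \<le> sisyphus.trap (k\<^sup>2)"
    using trap_lower_bound by blast
  then show basin: "emeasure lebesgue_circle (basin ?f (return borel ?p)) = 1"
    by (rule sisyphus.emeasure_basin)
  show "?f \<in> doubling_class" by (rule sisyphus.circle_map_F_in_doubling_class)
  show "{x. ?f x = x} = {?p}" by (rule sisyphus.fixed_points)
  show "?f -` {?p} = {?p, ?q}" by (rule sisyphus.preimages_of_fixed_point)
  show "?q \<noteq> ?p"
  proof
    assume "?q = ?p"
    then have "1 - half_point \<in> \<int>" by (simp add: circle_of_eq_iff)
    then show False using half_point Ints_nonzero_abs_less1[of "1 - half_point"] by simp
  qed
  show "smooth_circle_map_on ?f (- {?q})" by (rule smooth_sisyphus)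
  have "half_point ^ 5 < 8" using power_le_one[of half_point 5] half_point by simp
  then have "1 < \<bar>8 / half_point ^ 5\<bar>" using half_point by simp
  then show "sisyphus_attractor ?f ?p"
    unfolding sisyphus_attractor_def
    using sisyphus_derivative sisyphus.fixed_points basin by auto
qed

end
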